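(* The category $\mathcal{A}$ of algebraic $\mathcal{C}$-modules is locally noetherian: any subobject of a finitely generated object of $\mathcal{A}$ is again finitely generated.
   Context: All vector spaces are over $\mathbb{C}$. $\mathcal{C}$ is the category whose objects are pairs $(V,\omega)$ with $V$ a finite dimensional complex vector space and $\omega$ a non-degenerate symmetric bilinear form on $V$; a morphism $(V,\omega)\to(V',\omega')$ is a linear map $f\colon V\to V'$ with $\omega'(f(v_1),f(v_2))=\omega(v_1,v_2)$ for all $v_1,v_2\in V$. A $\mathcal{C}$-module is a functor from $\mathcal{C}$ to complex vector spaces. $T^n$ is the $\mathcal{C}$-module $V\mapsto V^{\otimes n}$ ($n\ge0$). A $\mathcal{C}$-module is algebraic if it is a subquotient of a (possibly infinite) direct sum of $T^n$'s (with varying $n$); $\mathcal{A}$ is the category of algebraic $\mathcal{C}$-modules. A $\mathcal{C}$-module $M$ is finitely generated if there are finitely many elements $x_i\in M(V_i)$ such that the smallest $\mathcal{C}$-submodule of $M$ containing all $x_i$ is $M$. *)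

theory Defs
  imports "HOL-Algebra.AbelCoset" "Jordan_Normal_Form.VS_Connect"
begin

hide_const (open) Modules.module_hom
hide_fact (open) Modules.module_hom_def

text \<open>
  Complex vector spaces are modules (in the sense of HOL-Algebra) over
  \<^term>\<open>class_ring :: complex ring\<close>, i.e. carrier sets inside an arbitrary type. The fields
  \<^term>\<open>mult\<close> and \<^term>\<open>one\<close> that the record type inherits from rings carry no meaning.
  The objects of \<open>\<C>\<close> are the quadratic spaces whose carrier lies in a type \<open>'v\<close>, which stays a type
  variable throughout; up to isomorphism these are all of them as soon as \<open>'v\<close> has at least the
  cardinality of the continuum.
\<close>

type_synonym 'v cvs = "(complex, 'v) module"

type_synonym 'v cobj = "'v cvs \<times> ('v \<Rightarrow> 'v \<Rightarrow> complex)"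

definition is_cobj :: "'v cobj \<Rightarrow> bool" where
  "is_cobj X \<longleftrightarrow> (case X of (V, \<omega>) \<Rightarrow>
     vectorspace class_ring V \<and> vectorspace.fin_dim class_ring V \<and>
     (\<forall>x\<in>carrier V. \<forall>y\<in>carrier V. \<forall>z\<in>carrier V. \<omega> (x \<oplus>\<^bsub>V\<^esub> y) z = \<omega> x z + \<omega> y z) \<and>
     (\<forall>a. \<forall>x\<in>carrier V. \<forall>z\<in>carrier V. \<omega> (a \<odot>\<^bsub>V\<^esub> x) z = a * \<omega> x z) \<and>
     (\<forall>x\<in>carrier V. \<forall>y\<in>carrier V. \<omega> x y = \<omega> y x) \<and>
     (\<forall>x\<in>carrier V. (\<forall>y\<in>carrier V. \<omega> x y = 0) \<longrightarrow> x = \<zero>\<^bsub>V\<^esub>))"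

text \<open>
  Linearity of \<open>\<omega>\<close> in the second argument follows from symmetry. Morphisms are required to be
  extensional, so that two morphisms are equal iff they agree on the carrier.
\<close>

definition chom :: "'v cobj \<Rightarrow> 'v cobj \<Rightarrow> ('v \<Rightarrow> 'v) set" where
  "chom X Y = {f \<in> module_hom class_ring (fst X) (fst Y) \<inter> extensional (carrier (fst X)).
     \<forall>x\<in>carrier (fst X). \<forall>y\<in>carrier (fst X). snd Y (f x) (f y) = snd X x y}"

definition cid :: "'v cobj \<Rightarrow> 'v \<Rightarrow> 'v" where
  "cid X = (\<lambda>x\<in>carrier (fst X). x)"

definition ccomp :: "'v cobj \<Rightarrow> ('v \<Rightarrow> 'v) \<Rightarrow> ('v \<Rightarrow> 'v) \<Rightarrow> 'v \<Rightarrow> 'v" where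
  "ccomp X g f = compose (carrier (fst X)) g f"

record ('v, 'm) cmodule =
  ob :: "'v cobj \<Rightarrow> 'm cvs"
  mor :: "'v cobj \<Rightarrow> 'v cobj \<Rightarrow> ('v \<Rightarrow> 'v) \<Rightarrow> 'm \<Rightarrow> 'm"

definition is_cmodule :: "('v, 'm) cmodule \<Rightarrow> bool" where
  "is_cmodule M \<longleftrightarrow>
     (\<forall>X. is_cobj X \<longrightarrow> vectorspace class_ring (ob M X)) \<and>
     (\<forall>X Y f. is_cobj X \<and> is_cobj Y \<and> f \<in> chom X Y \<longrightarrow>
        mor M X Y f \<in> module_hom class_ring (ob M X) (ob M Y)) \<and>
     (\<forall>X. is_cobj X \<longrightarrow> (\<forall>m\<in>carrier (ob M X). mor M X X (cid X) m = m)) \<and>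
     (\<forall>X Y Z f g. is_cobj X \<and> is_cobj Y \<and> is_cobj Z \<and> f \<in> chom X Y \<and> g \<in> chom Y Z \<longrightarrow>
        (\<forall>m\<in>carrier (ob M X). mor M X Z (ccomp X g f) m = mor M Y Z g (mor M X Y f m)))"

definition cmodule_hom ::
    "('v, 'm) cmodule \<Rightarrow> ('v, 'n) cmodule \<Rightarrow> ('v cobj \<Rightarrow> 'm \<Rightarrow> 'n) set" where
  "cmodule_hom M N = {\<phi>.
     (\<forall>X. is_cobj X \<longrightarrow> \<phi> X \<in> module_hom class_ring (ob M X) (ob N X)) \<and>
     (\<forall>X Y f. is_cobj X \<and> is_cobj Y \<and> f \<in> chom X Y \<longrightarrow>
        (\<forall>m\<in>carrier (ob M X). \<phi> Y (mor M X Y f m) = mor N X Y f (\<phi> X m)))}"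

definition is_csubmodule :: "('v, 'm) cmodule \<Rightarrow> ('v cobj \<Rightarrow> 'm set) \<Rightarrow> bool" where
  "is_csubmodule M S \<longleftrightarrow>
     (\<forall>X. is_cobj X \<longrightarrow> VectorSpace.subspace class_ring (S X) (ob M X)) \<and>
     (\<forall>X Y f. is_cobj X \<and> is_cobj Y \<and> f \<in> chom X Y \<longrightarrow> mor M X Y f ` S X \<subseteq> S Y)"

definition csubmodule :: "('v, 'm) cmodule \<Rightarrow> ('v cobj \<Rightarrow> 'm set) \<Rightarrow> ('v, 'm) cmodule" where
  "csubmodule M S = \<lparr>ob = (\<lambda>X. (ob M X)\<lparr>carrier := S X\<rparr>), mor = mor M\<rparr>"

text \<open>
  Monomorphisms and epimorphisms of \<open>\<C>\<close>-modules are the pointwise injective and pointwise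
  surjective morphisms. A subquotient is a quotient of a subobject.
\<close>

definition is_subobject ::
    "('v, 'n) cmodule \<Rightarrow> ('v cobj \<Rightarrow> 'n \<Rightarrow> 'm) \<Rightarrow> ('v, 'm) cmodule \<Rightarrow> bool" where
  "is_subobject N \<iota> M \<longleftrightarrow> is_cmodule N \<and> \<iota> \<in> cmodule_hom N M \<and>
     (\<forall>X. is_cobj X \<longrightarrow> inj_on (\<iota> X) (carrier (ob N X)))"

definition is_subquotient :: "('v, 'm) cmodule \<Rightarrow> ('v, 'p) cmodule \<Rightarrow> bool" where
  "is_subquotient M P \<longleftrightarrow> (\<exists>S \<phi>. is_csubmodule P S \<and> \<phi> \<in> cmodule_hom (csubmodule P S) M \<and>
     (\<forall>X. is_cobj X \<longrightarrow> \<phi> X ` S X = carrier (ob M X)))"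

definition generated_csubmodule ::
    "('v, 'm) cmodule \<Rightarrow> ('v cobj \<times> 'm) set \<Rightarrow> 'v cobj \<Rightarrow> 'm set" where
  "generated_csubmodule M G X = \<Inter>{S X | S. is_csubmodule M S \<and> (\<forall>(Y, y)\<in>G. y \<in> S Y)}"

definition finitely_generated_cmodule :: "('v, 'm) cmodule \<Rightarrow> bool" where
  "finitely_generated_cmodule M \<longleftrightarrow> (\<exists>G. finite G \<and>
     (\<forall>(Y, y)\<in>G. is_cobj Y \<and> y \<in> carrier (ob M Y)) \<and>
     (\<forall>X. is_cobj X \<longrightarrow> generated_csubmodule M G X = carrier (ob M X)))"

definition free_cvs :: "'b set \<Rightarrow> ('b \<Rightarrow> complex) cvs" where
  "free_cvs B = \<lparr>carrier = {c. finite {b. c b \<noteq> 0} \<and> {b. c b \<noteq> 0} \<subseteq> B},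
     mult = (\<lambda>c d b. 0), one = (\<lambda>b. 0), zero = (\<lambda>b. 0),
     add = (\<lambda>c d b. c b + d b), smult = (\<lambda>a c b. a * c b)\<rparr>"

definition free_basis :: "'b \<Rightarrow> 'b \<Rightarrow> complex" where
  "free_basis b = (\<lambda>b'. if b' = b then 1 else 0)"

definition free_map :: "('b \<Rightarrow> 'c) \<Rightarrow> ('b \<Rightarrow> complex) \<Rightarrow> 'c \<Rightarrow> complex" where
  "free_map f c = (\<lambda>y. \<Sum>b | c b \<noteq> 0 \<and> f b = y. c b)"

text \<open>
  The elements of \<open>V/W\<close> are the cosets of \<open>W\<close>. Adding \<open>W\<close> in the scalar multiplication makes
  \<open>0 \<cdot> A\<close> equal to \<open>W\<close> rather than to \<open>{0}\<close>.
\<close>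

definition quotient_cvs :: "'v cvs \<Rightarrow> 'v set \<Rightarrow> 'v set cvs" where
  "quotient_cvs V W = \<lparr>carrier = a_rcosets\<^bsub>V\<^esub> W,
     mult = (\<lambda>A B. W), one = W, zero = W,
     add = (\<lambda>A B. A <+>\<^bsub>V\<^esub> B), smult = (\<lambda>a A. W <+>\<^bsub>V\<^esub> ((\<lambda>x. a \<odot>\<^bsub>V\<^esub> x) ` A))\<rparr>"

text \<open>
  \<open>V\<^sup>\<otimes>\<^sup>n\<close> is the free vector space on \<open>V\<^sup>n\<close> modulo the relations that make
  \<open>(x\<^sub>1, \<dots>, x\<^sub>n) \<mapsto> x\<^sub>1 \<otimes> \<dots> \<otimes> x\<^sub>n\<close> multilinear.
\<close>

definition tuples :: "nat \<Rightarrow> 'v cvs \<Rightarrow> 'v list set" where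
  "tuples n V = {xs. length xs = n \<and> set xs \<subseteq> carrier V}"

definition tensor_relations :: "nat \<Rightarrow> 'v cvs \<Rightarrow> ('v list \<Rightarrow> complex) set" where
  "tensor_relations n V = LinearCombinations.module.span class_ring (free_cvs (tuples n V))
     ({(\<lambda>ys. free_basis (xs[i := x \<oplus>\<^bsub>V\<^esub> y]) ys
            - free_basis (xs[i := x]) ys - free_basis (xs[i := y]) ys) | xs i x y.
        xs \<in> tuples n V \<and> i < n \<and> x \<in> carrier V \<and> y \<in> carrier V} \<union>
      {(\<lambda>ys. free_basis (xs[i := a \<odot>\<^bsub>V\<^esub> x]) ys - a * free_basis (xs[i := x]) ys) | xs i a x.
        xs \<in> tuples n V \<and> i < n \<and> x \<in> carrier V})"

definition tensor_power :: "nat \<Rightarrow> 'v cvs \<Rightarrow> ('v list \<Rightarrow> complex) set cvs" where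
  "tensor_power n V = quotient_cvs (free_cvs (tuples n V)) (tensor_relations n V)"

definition tensor_power_map :: "nat \<Rightarrow> 'v cvs \<Rightarrow> ('v \<Rightarrow> 'v) \<Rightarrow>
    ('v list \<Rightarrow> complex) set \<Rightarrow> ('v list \<Rightarrow> complex) set" where
  "tensor_power_map n W f A =
     tensor_relations n W <+>\<^bsub>free_cvs (tuples n W)\<^esub> (free_map (map f) ` A)"

definition tensor_cmodule :: "nat \<Rightarrow> ('v, ('v list \<Rightarrow> complex) set) cmodule" where
  "tensor_cmodule n = \<lparr>ob = (\<lambda>X. tensor_power n (fst X)),
     mor = (\<lambda>X Y f. tensor_power_map n (fst Y) f)\<rparr>"

definition direct_sum_cvs :: "'i set \<Rightarrow> ('i \<Rightarrow> 'v cvs) \<Rightarrow> ('i \<Rightarrow> 'v) cvs" where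
  "direct_sum_cvs I V = \<lparr>
     carrier = {x \<in> (\<Pi>\<^sub>E i\<in>I. carrier (V i)). finite {i\<in>I. x i \<noteq> \<zero>\<^bsub>V i\<^esub>}},
     mult = (\<lambda>x y. \<lambda>i\<in>I. \<zero>\<^bsub>V i\<^esub>), one = (\<lambda>i\<in>I. \<zero>\<^bsub>V i\<^esub>), zero = (\<lambda>i\<in>I. \<zero>\<^bsub>V i\<^esub>),
     add = (\<lambda>x y. \<lambda>i\<in>I. x i \<oplus>\<^bsub>V i\<^esub> y i), smult = (\<lambda>a x. \<lambda>i\<in>I. a \<odot>\<^bsub>V i\<^esub> x i)\<rparr>"

definition direct_sum_cmodule ::
    "'i set \<Rightarrow> ('i \<Rightarrow> ('v, 'm) cmodule) \<Rightarrow> ('v, 'i \<Rightarrow> 'm) cmodule" where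
  "direct_sum_cmodule I M = \<lparr>ob = (\<lambda>X. direct_sum_cvs I (\<lambda>i. ob (M i) X)),
     mor = (\<lambda>X Y f x. \<lambda>i\<in>I. mor (M i) X Y f (x i))\<rparr>"

text \<open>
  The type argument bounds the size of the index set \<open>I\<close> of the direct sum, since a definition
  cannot quantify over types. A statement assuming \<open>algebraic_cmodule TYPE('i) M\<close> for a type variable
  \<open>'i\<close> covers direct sums with index sets of any size.
\<close>

definition algebraic_cmodule :: "'i itself \<Rightarrow> ('v, 'm) cmodule \<Rightarrow> bool" where
  "algebraic_cmodule _ M \<longleftrightarrow> is_cmodule M \<and>
     (\<exists>(I :: 'i set) (n :: 'i \<Rightarrow> nat).
        is_subquotient M (direct_sum_cmodule I (\<lambda>i. tensor_cmodule (n i))))"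

end

theory Submission
  imports Defs
begin

text \<open>
  Every object of \<open>\<C>\<close> has an orthonormal basis, so it is a standard space \<open>\<complex>\<^sup>d\<close>, and a strictly
  increasing map \<open>{0..<d} \<rightarrow> {0..<e}\<close> of basis indices extends to an isometric embedding
  \<open>\<complex>\<^sup>d \<rightarrow> \<complex>\<^sup>e\<close>. In this way a \<open>\<C>\<close>-module becomes a representation of the category of finite ordinals
  and strictly increasing maps. A finite direct sum \<open>P\<close> of modules \<open>T\<^sup>n\<close> is then spanned on \<open>\<complex>\<^sup>d\<close> by basis
  tensors, which are indexed by words: a summand together with a list of letters below \<open>d\<close>. Strictly
  increasing maps act on these by relabelling the letters (\<open>word_tensors_span\<close>, \<open>word_tensor_natural\<close>).

  A Groebner basis argument applies to \<open>P\<close>. Relabelling is strictly monotone for a well-order on words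
  (\<open>relabel_word_less\<close>), so an element \<open>q\<close> with leading word \<open>u\<close> is sent to an element whose leading word is
  the relabelled \<open>u\<close> (\<open>leading_word_pushforward\<close>). By Dickson's lemma, every set of words contains
  finitely many of which all others are relabellings (\<open>words_finite_basis\<close>). Hence a
  submodule of \<open>P\<close> contains finitely many elements whose images realise all leading words of its elements,
  and reduction by these elements terminates: they generate the submodule
  (\<open>csubmodule_word_sums_finitely_generated\<close>). Leading words are read off from coefficient functions on
  words and not from the tensors that these represent; a tensor may have several.

  The general case reduces to this one. Let \<open>M\<close> be the image under \<open>\<phi>\<close> of a submodule \<open>S\<close> of a direct sum of
  modules \<open>T\<^sup>n\<close>. Lifts to \<open>S\<close> of finitely many generators of \<open>M\<close> involve finitely many summands, so the
  elements of \<open>S\<close> supported on these summands already map onto \<open>M\<close>. The elements of \<open>S\<close> that \<open>\<phi>\<close> maps into a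
  submodule \<open>N\<close> of \<open>M\<close> form a submodule, and finitely many of them generate those with this
  support. Their images generate \<open>N\<close>.
\<close>

section \<open>Words and strictly increasing relabellings\<close>

text \<open>
  Dickson's lemma. In the step for a new coordinate \<open>i\<close>, take a basis \<open>B\<^sub>0\<close> for the other coordinates and let
  \<open>N\<close> bound its \<open>i\<close>-th coordinates. Elements whose \<open>i\<close>-th coordinate exceeds \<open>N\<close> are dominated by \<open>B\<^sub>0\<close>, and
  the remaining ones fall into \<open>N + 1\<close> slices on which the coordinate is constant.
\<close>

lemma Dickson_finite_basis:
  fixes \<phi> :: "'j \<Rightarrow> 'a \<Rightarrow> nat"
  assumes "finite J"
  shows "\<exists>B. finite B \<and> B \<subseteq> A \<and> (\<forall>a\<in>A. \<exists>b\<in>B. \<forall>j\<in>J. \<phi> j b \<le> \<phi> j a)"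
  using assms
proof (induction J arbitrary: A)
  case empty
  show ?case
  proof (cases "A = {}")
    case False
    then obtain a where "a \<in> A" by blast
    then show ?thesis by (intro exI[of _ "{a}"]) auto
  qed auto
next
  case (insert i J)
  obtain B0 where B0: "finite B0" "B0 \<subseteq> A" "\<forall>a\<in>A. \<exists>b\<in>B0. \<forall>j\<in>J. \<phi> j b \<le> \<phi> j a"
    using insert.IH[of A] by metis
  obtain N where N: "\<forall>b\<in>B0. \<phi> i b \<le> N"
    using B0(1) by (meson finite_imageI finite_nat_set_iff_bounded_le imageI)
  have "\<forall>k. \<exists>B. finite B \<and> B \<subseteq> {a\<in>A. \<phi> i a = k} \<and>
      (\<forall>a\<in>{a\<in>A. \<phi> i a = k}. \<exists>b\<in>B. \<forall>j\<in>J. \<phi> j b \<le> \<phi> j a)"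
    by (intro allI insert.IH)
  then obtain B where "\<forall>k. finite (B k) \<and> B k \<subseteq> {a\<in>A. \<phi> i a = k} \<and>
      (\<forall>a\<in>{a\<in>A. \<phi> i a = k}. \<exists>b\<in>B k. \<forall>j\<in>J. \<phi> j b \<le> \<phi> j a)"
    by (drule_tac choice) blast
  then have B: "\<And>k. finite (B k)" "\<And>k. B k \<subseteq> {a\<in>A. \<phi> i a = k}"
      "\<And>k a. a \<in> A \<Longrightarrow> \<phi> i a = k \<Longrightarrow> \<exists>b\<in>B k. \<forall>j\<in>J. \<phi> j b \<le> \<phi> j a"
    by simp_all
  have "\<exists>b\<in>B0 \<union> (\<Union>k\<le>N. B k). \<forall>j\<in>insert i J. \<phi> j b \<le> \<phi> j a" if "a \<in> A" for a
  proof (cases "\<phi> i a \<le> N")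
    case True
    from B(3)[OF that refl] obtain b where b: "b \<in> B (\<phi> i a)" "\<forall>j\<in>J. \<phi> j b \<le> \<phi> j a"
      by blast
    with B(2) have "\<phi> i b = \<phi> i a" by blast
    with b True show ?thesis by (intro bexI[of _ b]) auto
  next
    case False
    from B0(3) that obtain b where b: "b \<in> B0" "\<forall>j\<in>J. \<phi> j b \<le> \<phi> j a" by blast
    with N False have "\<phi> i b \<le> \<phi> i a" by (meson le_trans nat_le_linear)
    with b show ?thesis by (intro bexI[of _ b]) auto
  qed
  moreover have "finite (B0 \<union> (\<Union>k\<le>N. B k))" "B0 \<union> (\<Union>k\<le>N. B k) \<subseteq> A"
    using B0(1,2) B(1,2) by (auto dest: subsetD)
  ultimately show ?case by meson
qed

text \<open>
  The word \<open>h # w\<close> names the basis tensor \<open>e\<^bsub>w\<^sub>1\<^esub> \<otimes> \<dots> \<otimes> e\<^bsub>w\<^sub>n\<^esub>\<close> in the \<open>h\<close>-th summand of a direct sum of tensor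
  powers with exponents \<open>ns\<close>. Since its head is a summand number, the maps below act on its tail only.
\<close>

definition words :: "nat list \<Rightarrow> nat \<Rightarrow> nat list set" where
  "words ns d = {h # w | h w. h < length ns \<and> length w = ns ! h \<and> set w \<subseteq> {..<d}}"

definition relabel :: "(nat \<Rightarrow> nat) \<Rightarrow> nat list \<Rightarrow> nat list" where
  "relabel f u = hd u # map f (tl u)"

definition order_embeddings :: "nat \<Rightarrow> nat \<Rightarrow> (nat \<Rightarrow> nat) set" where
  "order_embeddings d e = {f. strict_mono_on {..<d} f \<and> f ` {..<d} \<subseteq> {..<e}}"

lemma finite_words: "finite (words ns d)"
proof -
  have "words ns d \<subseteq> (\<Union>h<length ns. (#) h ` {w. set w \<subseteq> {..<d} \<and> length w = ns ! h})"
    unfolding words_def by auto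
  then show ?thesis
    by (rule finite_subset) (auto intro!: finite_lists_length_eq)
qed

lemma relabel_words:
  assumes "f \<in> order_embeddings d e" "u \<in> words ns d"
  shows "relabel f u \<in> words ns e"
  using assms unfolding order_embeddings_def words_def relabel_def by fastforce

text \<open>
  An embedding taking the letters of \<open>w\<close> to those of \<open>w'\<close> exists as soon as there is room for it: the points
  below, between and above the letters of \<open>w\<close> must fit into the corresponding gaps of \<open>w'\<close>. A point \<open>x\<close> must
  go to a position \<open>\<ge> x\<close>, and to one at least as far from the image of each letter to its left as \<open>x\<close> is from that
  letter; the least position with these properties defines a strictly increasing map. The hypotheses use truncated subtraction, so that \<open>gaps\<close> speaks only of
  pairs with \<open>w ! j < w ! i\<close>.
\<close>

lemma order_embedding_exists:
  fixes w w' :: "nat list"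
  assumes len: "length w = length w'" and w: "set w \<subseteq> {..<d}"
    and de: "d \<le> e"
    and letters: "\<And>i. i < length w \<Longrightarrow> w ! i \<le> w' ! i \<and> w' ! i < e \<and> d - w ! i \<le> e - w' ! i"
    and gaps: "\<And>i j. i < length w \<Longrightarrow> j < length w \<Longrightarrow> w ! i - w ! j \<le> w' ! i - w' ! j"
    and eqs: "\<And>i j. i < length w \<Longrightarrow> j < length w \<Longrightarrow> w ! i = w ! j \<Longrightarrow> w' ! i = w' ! j"
  shows "\<exists>f\<in>order_embeddings d e. map f w = w'"
proof -
  define C where "C x = insert x ((\<lambda>i. w' ! i + (x - w ! i)) ` {i. i < length w \<and> w ! i \<le> x})" for x
  define f where "f x = Max (C x)" for x
  have fin: "finite (C x)" and ne: "C x \<noteq> {}" for x unfolding C_def by auto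
  \<comment> \<open>Moving from \<open>x\<close> to \<open>y\<close> adds \<open>y - x\<close> to every candidate and can only add new ones.\<close>
  have mono: "f x < f y" if "x < y" for x y
  proof -
    have "f x \<in> C x" unfolding f_def using Max_in[OF fin ne] .
    then have "f x + (y - x) \<in> C y"
      using that unfolding C_def by force
    then have "f x + (y - x) \<le> f y" unfolding f_def by (rule Max_ge[OF fin])
    with that show ?thesis by simp
  qed
  have range: "f x < e" if "x < d" for x
  proof -
    have "f x \<in> C x" unfolding f_def using Max_in[OF fin ne] .
    then show ?thesis
    proof (unfold C_def, elim insertE imageE CollectE conjE)
      fix i assume i: "f x = w' ! i + (x - w ! i)" "i < length w" "w ! i \<le> x"
      then show "f x < e" using letters[of i] that by linarith
    qed (use that de in auto)
  qed
  have val: "f (w ! i) = w' ! i" if i: "i < length w" for i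
    unfolding f_def
  proof (rule Max_eqI[OF fin])
    show "w' ! i \<in> C (w ! i)" unfolding C_def using i by force
    fix y assume "y \<in> C (w ! i)"
    then show "y \<le> w' ! i"
    proof (unfold C_def, elim insertE imageE CollectE conjE)
      fix j assume j: "y = w' ! j + (w ! i - w ! j)" "j < length w" "w ! j \<le> w ! i"
      then show "y \<le> w' ! i"
        using gaps[of i j] eqs[of i j] i by (cases "w ! i = w ! j") auto
    qed (use letters i in auto)
  qed
  have "map f w = w'"
    using len val by (intro nth_equalityI) auto
  moreover have "f \<in> order_embeddings d e"
    using mono range unfolding order_embeddings_def strict_mono_on_def by auto
  ultimately show ?thesis by blast
qed

text \<open>
  A pair \<open>(d, u)\<close> is encoded by finitely many numbers in such a way that coordinatewise comparison of the
  encodings gives the hypotheses of \<open>order_embedding_exists\<close>. The summand numbers \<open>h\<close> must agree rather than be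
  comparable, which the two coordinates \<open>h\<close> and \<open>k - h\<close> achieve together.
\<close>

lemma words_finite_basis:
  assumes A: "\<And>d u. (d, u) \<in> A \<Longrightarrow> u \<in> words ns d"
  shows "\<exists>B. finite B \<and> B \<subseteq> A \<and>
    (\<forall>(e, v)\<in>A. \<exists>(d, u)\<in>B. \<exists>f\<in>order_embeddings d e. relabel f u = v)"
proof -
  define k where "k = length ns"
  define m where "m = Max (insert 0 (set ns))"
  \<comment> \<open>Position \<open>0\<close> of a word holds the summand number. \<open>L\<close> puts the bound \<open>d\<close> there, so that the room above
    a letter is one more difference, and also beyond the end, so that all words have the same coordinates.\<close>
  define L where "L = (\<lambda>(d :: nat, u) i. if i < length u \<and> 0 < i then u ! i else d)"
  define \<phi> :: "nat \<times> nat \<times> nat \<Rightarrow> nat \<times> nat list \<Rightarrow> nat" where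
    "\<phi> = (\<lambda>(t, i, j) a.
       if t = 0 then L a i - L a j
       else if t = 1 then of_bool (L a i = L a j)
       else if t = 2 then L a i
       else if t = 3 then hd (snd a)
       else k - hd (snd a))"
  obtain B where B: "finite B" "B \<subseteq> A"
    "\<And>a. a \<in> A \<Longrightarrow> \<exists>b\<in>B. \<forall>j\<in>{..4} \<times> {..m + 1} \<times> {..m + 1}. \<phi> j b \<le> \<phi> j a"
    using Dickson_finite_basis[of "{..4} \<times> {..m + 1} \<times> {..m + 1}" A \<phi>] by auto
  have "\<exists>(d, u)\<in>B. \<exists>f\<in>order_embeddings d e. relabel f u = v" if "(e, v) \<in> A" for e v
  proof -
    from B(3)[OF that] obtain d u where b: "(d, u) \<in> B"
      and le: "\<And>t i j. t \<le> 4 \<Longrightarrow> i \<le> m + 1 \<Longrightarrow> j \<le> m + 1 \<Longrightarrow> \<phi> (t, i, j) (d, u) \<le> \<phi> (t, i, j) (e, v)"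
      by (metis (no_types, lifting) SigmaI atMost_iff surj_pair)
    from A[OF that] obtain h' w' where v: "v = h' # w'" "h' < k" "length w' = ns ! h'" "set w' \<subseteq> {..<e}"
      unfolding words_def k_def by auto
    from b B(2) have "u \<in> words ns d" by (intro A) blast
    then obtain h w where u: "u = h # w" "h < k" "length w = ns ! h" "set w \<subseteq> {..<d}"
      unfolding words_def k_def by auto
    have "h \<le> h'" "k - h \<le> k - h'"
      using le[of 3 0 0] le[of 4 0 0] by (auto simp: \<phi>_def u(1) v(1))
    then have h: "h' = h" using u v by simp
    then have len: "length w = length w'" using u v by simp
    have "ns ! h \<le> m" unfolding m_def using u(2) k_def by (intro Max_ge) auto
    then have wm: "length w \<le> m" using u by simp
    have lu: "L (d, u) (Suc i) = w ! i" "L (e, v) (Suc i) = w' ! i" if "i < length w" for i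
      using that len by (auto simp: L_def u(1) v(1))
    have l0: "L (d, u) 0 = d" "L (e, v) 0 = e"
      by (auto simp: L_def)
    have "\<exists>f\<in>order_embeddings d e. map f w = w'"
    proof (rule order_embedding_exists[OF len u(4)])
      show "d \<le> e" using le[of 2 0 0] by (simp add: \<phi>_def l0)
      fix i assume i: "i < length w"
      have "w' ! i < e" using v(4) i len nth_mem[of i w'] by (metis lessThan_iff subsetD)
      then show "w ! i \<le> w' ! i \<and> w' ! i < e \<and> d - w ! i \<le> e - w' ! i"
        using le[of 2 "Suc i" 0] le[of 0 0 "Suc i"] i wm
        by (auto simp: \<phi>_def l0 lu)
      fix j assume j: "j < length w"
      show "w ! i - w ! j \<le> w' ! i - w' ! j"
        using le[of 0 "Suc i" "Suc j"] i j wm by (auto simp: \<phi>_def lu)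
      show "w' ! i = w' ! j" if "w ! i = w ! j"
        using le[of 1 "Suc i" "Suc j"] i j wm that by (auto simp: \<phi>_def lu of_bool_def split: if_splits)
    qed
    then have "\<exists>f\<in>order_embeddings d e. relabel f u = v"
      unfolding relabel_def u(1) v(1) h by simp
    then show ?thesis using b by blast
  qed
  with B(1,2) show ?thesis by auto
qed

text \<open>
  The length-lexicographic order is a well-order on words, and it compares letters only by
  their order, which embeddings preserve.
\<close>

definition word_less :: "(nat list \<times> nat list) set" where
  "word_less = lenlex less_than"

lemma relabel_word_less:
  assumes f: "f \<in> order_embeddings d e" and u: "u \<in> words ns d" and v: "v \<in> words ns d"
    and uv: "(u, v) \<in> word_less"
  shows "(relabel f u, relabel f v) \<in> word_less"
proof -
  have lex: "(map f w, map f w') \<in> lex less_than"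
    if "(w, w') \<in> lex less_than" "set w \<subseteq> {..<d}" "set w' \<subseteq> {..<d}" for w w'
  proof -
    from that(1) obtain xs x xs' y ys' where 
      "length w = length w'" "w = xs @ x # xs'" "w' = xs @ y # ys'" "x < y"
      unfolding lex_conv by auto
    moreover have "f x < f y"
      using f that \<open>x < y\<close> calculation unfolding order_embeddings_def strict_mono_on_def by auto
    ultimately show ?thesis unfolding lex_conv by auto
  qed
  from u v obtain h w h' w' where "u = h # w" "set w \<subseteq> {..<d}" "v = h' # w'" "set w' \<subseteq> {..<d}"
    unfolding words_def by auto
  with uv lex[of w w'] show ?thesis
    unfolding word_less_def relabel_def by (auto simp: lenlex_conv)
qed

lemma inj_on_relabel:
  assumes f: "f \<in> order_embeddings d e" shows "inj_on (relabel f) (words ns d)"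
proof (rule inj_onI)
  fix u v assume "u \<in> words ns d" "v \<in> words ns d" and eq: "relabel f u = relabel f v"
  then obtain h w h' w' where uv: "u = h # w" "set w \<subseteq> {..<d}" "v = h' # w'" "set w' \<subseteq> {..<d}"
    unfolding words_def by auto
  have "inj_on f {..<d}"
    using f unfolding order_embeddings_def by (auto intro: strict_mono_on_imp_inj_on)
  moreover have "set w \<union> set w' \<subseteq> {..<d}" using uv by simp
  ultimately have "inj_on f (set w \<union> set w')" by (rule inj_on_subset)
  then show "u = v" using eq uv by (auto simp: relabel_def dest: map_inj_on)
qed

lemma leading_word_exists:
  assumes "finite A" "A \<noteq> {}"
  shows "\<exists>u\<in>A. \<forall>v\<in>A. v = u \<or> (v, u) \<in> word_less"
  using assms
proof (induction rule: finite_ne_induct)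
  case (insert x F)
  then obtain u where u: "u \<in> F" "\<forall>v\<in>F. v = u \<or> (v, u) \<in> word_less" by blast
  have "total word_less" "trans word_less"
    unfolding word_less_def by (auto intro: total_lenlex lenlex_trans transI)
  then consider "x = u" | "(x, u) \<in> word_less" | "(u, x) \<in> word_less"
    unfolding total_on_def by blast
  then show ?case
    using u \<open>trans word_less\<close> by cases (auto dest: transD)
qed auto

section \<open>Orthonormal frames and isometries\<close>

text \<open>
  Linear combinations of an indexed family. Different words may represent equal tensors, so the index
  cannot be replaced by the vector as in \<open>lincomb\<close>.
\<close>

definition lincomb_family :: "'v cvs \<Rightarrow> ('u \<Rightarrow> complex) \<Rightarrow> ('u \<Rightarrow> 'v) \<Rightarrow> 'u set \<Rightarrow> 'v" where
  "lincomb_family V a b A = (\<Oplus>\<^bsub>V\<^esub>u\<in>A. a u \<odot>\<^bsub>V\<^esub> b u)"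

context
  fixes V :: "'v cvs" and b :: "'u \<Rightarrow> 'v" and A :: "'u set"
  assumes V: "Module.module class_ring V" and b: "b \<in> A \<rightarrow> carrier V"
begin

interpretation V: Module.module "class_ring :: complex ring" V by (rule V)

lemma lincomb_family_closed: "lincomb_family V a b A \<in> carrier V"
  unfolding lincomb_family_def using b by (intro V.finsum_closed) auto

lemma lincomb_family_insert:
  assumes "u \<in> A" "B \<subseteq> A" "finite B" "u \<notin> B"
  shows "lincomb_family V a b (insert u B) = a u \<odot>\<^bsub>V\<^esub> b u \<oplus>\<^bsub>V\<^esub> lincomb_family V a b B"
  unfolding lincomb_family_def using assms b by (intro V.finsum_insert) (auto simp: Pi_iff subset_iff)

lemma lincomb_family_add:
  assumes "finite A"
  shows "lincomb_family V (\<lambda>u. a u + a' u) b A = lincomb_family V a b A \<oplus>\<^bsub>V\<^esub> lincomb_family V a' b A"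
proof -
  have "lincomb_family V (\<lambda>u. a u + a' u) b A = (\<Oplus>\<^bsub>V\<^esub>u\<in>A. a u \<odot>\<^bsub>V\<^esub> b u \<oplus>\<^bsub>V\<^esub> a' u \<odot>\<^bsub>V\<^esub> b u)"
    unfolding lincomb_family_def
    using b by (intro V.finsum_cong') (auto simp: V.smult_l_distr[simplified] Pi_iff)
  also have "\<dots> = lincomb_family V a b A \<oplus>\<^bsub>V\<^esub> lincomb_family V a' b A"
    unfolding lincomb_family_def using b by (intro V.finsum_addf) auto
  finally show ?thesis .
qed

lemma lincomb_family_smult:
  assumes "finite A"
  shows "lincomb_family V (\<lambda>u. s * a u) b A = s \<odot>\<^bsub>V\<^esub> lincomb_family V a b A"
proof -
  have "lincomb_family V (\<lambda>u. s * a u) b A = (\<Oplus>\<^bsub>V\<^esub>u\<in>A. s \<odot>\<^bsub>V\<^esub> (a u \<odot>\<^bsub>V\<^esub> b u))"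
    unfolding lincomb_family_def
    using b by (intro V.finsum_cong') (auto simp: V.smult_assoc1[simplified] Pi_iff)
  also have "\<dots> = s \<odot>\<^bsub>V\<^esub> lincomb_family V a b A"
    unfolding lincomb_family_def using b assms by (intro V.finsum_smult[symmetric]) auto
  finally show ?thesis .
qed

lemma lincomb_family_eq_0:
  assumes "\<And>u. u \<in> A \<Longrightarrow> a u = 0"
  shows "lincomb_family V a b A = \<zero>\<^bsub>V\<^esub>"
proof -
  have "lincomb_family V a b A = (\<Oplus>\<^bsub>V\<^esub>u\<in>A. \<zero>\<^bsub>V\<^esub>)"
    unfolding lincomb_family_def
    using assms b V.lmult_0 by (intro V.finsum_cong') (auto simp: Pi_iff)
  then show ?thesis by simp
qed

lemma lincomb_family_single:
  assumes "finite A" "u \<in> A"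
  shows "lincomb_family V (\<lambda>u'. if u' = u then s else 0) b A = s \<odot>\<^bsub>V\<^esub> b u"
proof -
  have "lincomb_family V (\<lambda>u'. if u' = u then s else 0) b A =
      (\<Oplus>\<^bsub>V\<^esub>u'\<in>A. if u = u' then s \<odot>\<^bsub>V\<^esub> b u' else \<zero>\<^bsub>V\<^esub>)"
    unfolding lincomb_family_def
    using b V.lmult_0 by (intro V.finsum_cong') (auto simp: Pi_iff)
  also have "\<dots> = s \<odot>\<^bsub>V\<^esub> b u"
    using assms b by (intro V.finsum_singleton) auto
  finally show ?thesis .
qed

lemma lincomb_family_mem:
  assumes "finite A" "submodule class_ring N V" "b \<in> A \<rightarrow> N"
  shows "lincomb_family V a b A \<in> N"
proof -
  interpret N: submodule "class_ring :: complex ring" N V by (rule assms(2))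
  have "lincomb_family V a b B \<in> N" if "B \<subseteq> A" for B
    using finite_subset[OF that assms(1)] that
  proof (induction rule: finite_induct)
    case empty
    then show ?case using N.zero_closed by (simp add: lincomb_family_def)
  next
    case (insert u B)
    then show ?case using assms(3) by (auto simp: lincomb_family_insert Pi_iff)
  qed
  then show ?thesis by simp
qed

lemma hom_lincomb_family:
  assumes "finite A" "Module.module class_ring W" and g: "g \<in> module_hom class_ring V W"
  shows "g (lincomb_family V a b A) = lincomb_family W a (\<lambda>u. g (b u)) A"
proof -
  interpret W: Module.module "class_ring :: complex ring" W by (rule assms(2))
  interpret g: mod_hom "class_ring :: complex ring" V W g
    using V assms(2,3) by (simp add: mod_hom_def mod_hom_axioms_def)
  have "g (lincomb_family V a b B) = lincomb_family W a (\<lambda>u. g (b u)) B" if "B \<subseteq> A" for B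
    using finite_subset[OF that assms(1)] that
  proof (induction rule: finite_induct)
    case empty
    then show ?case by (simp add: lincomb_family_def)
  next
    case (insert u B)
    have bB: "b \<in> B \<rightarrow> carrier V" "b u \<in> carrier V" using b insert by auto
    then have "g (lincomb_family V a b (insert u B)) =
        a u \<odot>\<^bsub>W\<^esub> g (b u) \<oplus>\<^bsub>W\<^esub> g (lincomb_family V a b B)"
      using insert by (simp add: lincomb_family_def Pi_iff)
    also have "\<dots> = lincomb_family W a (\<lambda>u. g (b u)) (insert u B)"
      using insert bB unfolding lincomb_family_def
      by (subst W.finsum_insert) (auto simp: Pi_iff)
    finally show ?case .
  qed
  then show ?thesis by simp
qed

end

lemma lincomb_family_cong:
  assumes "Module.module class_ring V" "b \<in> A \<rightarrow> carrier V"
    and "\<And>u. u \<in> A \<Longrightarrow> a u = a' u" "\<And>u. u \<in> A \<Longrightarrow> b u = b' u"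
  shows "lincomb_family V a b A = lincomb_family V a' b' A"
proof -
  interpret Module.module "class_ring :: complex ring" V by (rule assms(1))
  show ?thesis
    unfolding lincomb_family_def using assms(2-4) by (intro finsum_cong') (auto simp: Pi_iff)
qed

locale quadratic_space = vectorspace "class_ring :: complex ring" V
  for V :: "'v cvs" +
  fixes \<omega> :: "'v \<Rightarrow> 'v \<Rightarrow> complex"
  assumes fin_dim: "fin_dim"
    and form_add: "x \<in> carrier V \<Longrightarrow> y \<in> carrier V \<Longrightarrow> z \<in> carrier V \<Longrightarrow> \<omega> (x \<oplus>\<^bsub>V\<^esub> y) z = \<omega> x z + \<omega> y z"
    and form_smult: "x \<in> carrier V \<Longrightarrow> z \<in> carrier V \<Longrightarrow> \<omega> (a \<odot>\<^bsub>V\<^esub> x) z = a * \<omega> x z"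
    and form_sym: "x \<in> carrier V \<Longrightarrow> y \<in> carrier V \<Longrightarrow> \<omega> x y = \<omega> y x"
    and form_nondegenerate: "x \<in> carrier V \<Longrightarrow> x \<noteq> \<zero>\<^bsub>V\<^esub> \<Longrightarrow> \<exists>y\<in>carrier V. \<omega> x y \<noteq> 0"

lemma is_cobj_iff_quadratic_space: "is_cobj X \<longleftrightarrow> quadratic_space (fst X) (snd X)"
  unfolding is_cobj_def quadratic_space_def quadratic_space_axioms_def
  by (auto simp: split_beta)

definition orthonormal_family :: "'v cobj \<Rightarrow> nat \<Rightarrow> (nat \<Rightarrow> 'v) \<Rightarrow> bool" where
  "orthonormal_family X d b \<longleftrightarrow> b \<in> {..<d} \<rightarrow> carrier (fst X) \<and>
     (\<forall>i<d. \<forall>j<d. snd X (b i) (b j) = (if i = j then 1 else 0))"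

text \<open>
  That \<open>b\<close> spans is expressed by the reconstruction formula \<open>x = \<Sum>\<^sub>i \<omega>(x, b\<^sub>i) b\<^sub>i\<close>, which makes coordinates,
  and hence isometries out of \<open>X\<close>, explicit.
\<close>

definition orthonormal_frame :: "'v cobj \<Rightarrow> nat \<Rightarrow> (nat \<Rightarrow> 'v) \<Rightarrow> bool" where
  "orthonormal_frame X d b \<longleftrightarrow> orthonormal_family X d b \<and>
     (\<forall>x\<in>carrier (fst X). lincomb_family (fst X) (\<lambda>i. snd X x (b i)) b {..<d} = x)"

context quadratic_space
begin

lemma is_module: "Module.module class_ring V" ..

lemma form_zero: "z \<in> carrier V \<Longrightarrow> \<omega> \<zero>\<^bsub>V\<^esub> z = 0"
  using form_smult[of "\<zero>\<^bsub>V\<^esub>" z 0] by simp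

lemma form_lincomb:
  assumes "finite A" "b \<in> A \<rightarrow> carrier V" "z \<in> carrier V"
  shows "\<omega> (lincomb_family V a b A) z = (\<Sum>u\<in>A. a u * \<omega> (b u) z)"
  using assms
proof (induction rule: finite_induct)
  case empty
  then show ?case by (simp add: lincomb_family_def form_zero)
next
  case (insert u A)
  then have "b u \<in> carrier V" "b \<in> A \<rightarrow> carrier V" by auto
  with insert show ?case
    by (simp add: lincomb_family_insert[OF is_module, of b "insert u A"] subset_insertI form_add form_smult
        lincomb_family_closed[OF is_module])
qed

lemma form_lincomb_orthonormal:
  assumes b: "orthonormal_family (V, \<omega>) d b" and "j < d"
  shows "\<omega> (lincomb_family V a b {..<d}) (b j) = a j"
proof -
  have bc: "b \<in> {..<d} \<rightarrow> carrier V" using b by (simp add: orthonormal_family_def)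
  have "\<omega> (lincomb_family V a b {..<d}) (b j) = (\<Sum>i<d. a i * \<omega> (b i) (b j))"
    using bc \<open>j < d\<close> by (intro form_lincomb) auto
  also have "\<dots> = (\<Sum>i<d. if i = j then a i else 0)"
    using b \<open>j < d\<close> by (intro sum.cong) (auto simp: orthonormal_family_def)
  finally show ?thesis using \<open>j < d\<close> by simp
qed

text \<open>
  Pairing with \<open>b\<^sub>j\<close> recovers the \<open>j\<close>-th coefficient of a linear combination, so the family is linearly independent.
\<close>

lemma orthonormal_family_le_dim:
  assumes b: "orthonormal_family (V, \<omega>) d b"
  shows "d \<le> dim"
proof -
  have bc: "b \<in> {..<d} \<rightarrow> carrier V" using b by (simp add: orthonormal_family_def)
  have inj: "inj_on b {..<d}"
  proof (rule inj_onI)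
    fix i j assume "i \<in> {..<d}" "j \<in> {..<d}" "b i = b j"
    then show "i = j" using b unfolding orthonormal_family_def
      by (metis lessThan_iff snd_conv zero_neq_one)
  qed
  have "lin_indpt (b ` {..<d})"
  proof (rule finite_lin_indpt2)
    fix a assume a: "lincomb a (b ` {..<d}) = \<zero>\<^bsub>V\<^esub>"
    have "lincomb a (b ` {..<d}) = lincomb_family V (\<lambda>i. a (b i)) b {..<d}"
      unfolding lincomb_def lincomb_family_def using bc inj by (subst finsum_reindex) auto
    then have "a (b j) = 0" if "j < d" for j
      using form_lincomb_orthonormal[OF b that, of "\<lambda>i. a (b i)"] form_zero[of "b j"] a bc that by auto
    then show "\<forall>v\<in>b ` {..<d}. a v = \<zero>\<^bsub>class_ring\<^esub>" by auto
  qed (use bc in auto)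
  then have "card (b ` {..<d}) \<le> dim"
    using bc by (intro li_le_dim fin_dim) auto
  then show ?thesis using inj by (simp add: card_image)
qed

text \<open>
  The component of \<open>x\<close> orthogonal to the family \<open>b\<close>.
\<close>

definition residual :: "nat \<Rightarrow> (nat \<Rightarrow> 'v) \<Rightarrow> 'v \<Rightarrow> 'v" where
  "residual d b x = x \<oplus>\<^bsub>V\<^esub> (-1) \<odot>\<^bsub>V\<^esub> lincomb_family V (\<lambda>i. \<omega> x (b i)) b {..<d}"

lemma residual:
  assumes b: "orthonormal_family (V, \<omega>) d b" and x: "x \<in> carrier V"
  shows residual_closed: "residual d b x \<in> carrier V"
    and residual_orthogonal: "j < d \<Longrightarrow> \<omega> (residual d b x) (b j) = 0"
    and form_residual: "z \<in> carrier V \<Longrightarrow> (\<And>j. j < d \<Longrightarrow> \<omega> z (b j) = 0) \<Longrightarrow> \<omega> (residual d b x) z = \<omega> x z"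
proof -
  have bc: "b \<in> {..<d} \<rightarrow> carrier V" using b by (simp add: orthonormal_family_def)
  define p where "p = lincomb_family V (\<lambda>i. \<omega> x (b i)) b {..<d}"
  have p: "p \<in> carrier V" unfolding p_def by (rule lincomb_family_closed[OF is_module bc])
  then show "residual d b x \<in> carrier V" using x by (simp add: residual_def p_def)
  have eq: "\<omega> (residual d b x) z = \<omega> x z - \<omega> p z" if "z \<in> carrier V" for z
    using p x that by (simp add: residual_def p_def form_add form_smult)
  show "\<omega> (residual d b x) (b j) = 0" if "j < d"
    using eq[of "b j"] that bc form_lincomb_orthonormal[OF b that] by (auto simp: p_def)
  show "\<omega> (residual d b x) z = \<omega> x z" if z: "z \<in> carrier V" "\<And>j. j < d \<Longrightarrow> \<omega> z (b j) = 0"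
  proof -
    have "\<omega> p z = (\<Sum>i<d. \<omega> x (b i) * \<omega> (b i) z)"
      unfolding p_def using bc z by (intro form_lincomb) auto
    also have "\<dots> = 0"
      using bc z form_sym by (intro sum.neutral) (auto simp: Pi_iff)
    finally show ?thesis using eq z by simp
  qed
qed

text \<open>
  Over \<open>\<complex>\<close> any non-isotropic vector can be normalised, since \<open>\<omega>(z, z)\<close> has a square root.
\<close>

lemma orthonormal_family_extend:
  assumes b: "orthonormal_family (V, \<omega>) d b" and z: "z \<in> carrier V" "\<omega> z z \<noteq> 0"
    and orth: "\<And>j. j < d \<Longrightarrow> \<omega> z (b j) = 0"
  shows "\<exists>b'. orthonormal_family (V, \<omega>) (Suc d) b'"
proof -
  have bc: "b \<in> {..<d} \<rightarrow> carrier V" using b by (simp add: orthonormal_family_def)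
  define s where "s = 1 / csqrt (\<omega> z z)"
  define e where "e = s \<odot>\<^bsub>V\<^esub> z"
  have ec: "e \<in> carrier V" unfolding e_def using z by simp
  have "\<omega> e e = s * (s * \<omega> z z)"
    using z ec form_sym[of z e] by (simp add: e_def form_smult)
  also have "s * s * csqrt (\<omega> z z) ^ 2 = 1"
    unfolding s_def using z by (simp add: field_simps power2_eq_square del: power2_csqrt)
  then have "s * (s * \<omega> z z) = 1" by (simp add: mult.assoc)
  finally have ee: "\<omega> e e = 1" .
  have eb: "\<omega> e (b j) = 0" "\<omega> (b j) e = 0" if "j < d" for j
  proof -
    show "\<omega> e (b j) = 0" using z orth[OF that] bc that by (simp add: e_def form_smult Pi_iff)
    then show "\<omega> (b j) e = 0" using form_sym[of e "b j"] ec bc that by auto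
  qed
  have "orthonormal_family (V, \<omega>) (Suc d) (b(d := e))"
    using b ec ee eb unfolding orthonormal_family_def by (auto simp: less_Suc_eq)
  then show ?thesis by blast
qed

text \<open>
  A longest orthonormal family \<open>b\<close> is a frame. All vectors orthogonal to it are isotropic, because one that
  is not would extend it. By polarisation \<open>\<omega>\<close> vanishes on the orthogonal complement of \<open>b\<close>. A residual \<open>x'\<close>
  pairs with any \<open>y\<close> as with the residual of \<open>y\<close>, so \<open>x'\<close> lies in the radical of \<open>\<omega>\<close> and is zero.
\<close>

lemma orthonormal_frame_exists: "\<exists>d b. orthonormal_frame (V, \<omega>) d b"
proof -
  have "orthonormal_family (V, \<omega>) 0 undefined" by (simp add: orthonormal_family_def)
  then have "\<exists>d b. orthonormal_family (V, \<omega>) d b" by blast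
  then obtain d where d: "\<exists>b. orthonormal_family (V, \<omega>) d b"
      "\<And>d'. \<exists>b. orthonormal_family (V, \<omega>) d' b \<Longrightarrow> d' \<le> d"
    using GreatestI_ex_nat[of "\<lambda>d. \<exists>b. orthonormal_family (V, \<omega>) d b" dim]
      Greatest_le_nat[of "\<lambda>d. \<exists>b. orthonormal_family (V, \<omega>) d b" _ dim]
      orthonormal_family_le_dim by metis
  then obtain b where b: "orthonormal_family (V, \<omega>) d b" by blast
  have bc: "b \<in> {..<d} \<rightarrow> carrier V" using b by (simp add: orthonormal_family_def)
  note R = residual[OF b]
  have isotropic: "\<omega> z z = 0" if "z \<in> carrier V" "\<And>j. j < d \<Longrightarrow> \<omega> z (b j) = 0" for z
    using orthonormal_family_extend[OF b that(1) _ that(2)] d(2)[of "Suc d"] by fastforce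
  have "lincomb_family V (\<lambda>i. \<omega> x (b i)) b {..<d} = x" if x: "x \<in> carrier V" for x
  proof -
    define x' where "x' = residual d b x"
    have x': "x' \<in> carrier V" "\<And>j. j < d \<Longrightarrow> \<omega> x' (b j) = 0"
      unfolding x'_def using R[OF x] by auto
    have "\<omega> x' y = 0" if y: "y \<in> carrier V" for y
    proof -
      define y' where "y' = residual d b y"
      have y': "y' \<in> carrier V" "\<And>j. j < d \<Longrightarrow> \<omega> y' (b j) = 0"
        unfolding y'_def using R[OF y] by auto
      have s: "x' \<oplus>\<^bsub>V\<^esub> y' \<in> carrier V" using x' y' by simp
      have "\<omega> (x' \<oplus>\<^bsub>V\<^esub> y') (x' \<oplus>\<^bsub>V\<^esub> y') = 0"
      proof (rule isotropic[OF s])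
        fix j assume "j < d"
        then show "\<omega> (x' \<oplus>\<^bsub>V\<^esub> y') (b j) = 0" using x' y' bc by (simp add: form_add Pi_iff)
      qed
      moreover have "\<omega> x' x' = 0" "\<omega> y' y' = 0" using isotropic x' y' by auto
      ultimately have "2 * \<omega> y' x' = 0"
        using x'(1) y'(1) s form_sym[of x' "x' \<oplus>\<^bsub>V\<^esub> y'"] form_sym[of y' "x' \<oplus>\<^bsub>V\<^esub> y'"] form_sym[of x' y']
        by (simp add: form_add)
      then have "\<omega> y' x' = 0" by simp
      moreover have "\<omega> y' x' = \<omega> y x'"
        unfolding y'_def using R(3)[OF y x'] by simp
      ultimately show ?thesis using form_sym x' y by simp
    qed
    then have "x' = \<zero>\<^bsub>V\<^esub>" using form_nondegenerate x'(1) by blast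
    define p where "p = lincomb_family V (\<lambda>i. \<omega> x (b i)) b {..<d}"
    have p: "p \<in> carrier V" unfolding p_def by (rule lincomb_family_closed[OF is_module bc])
    have "x \<oplus>\<^bsub>V\<^esub> (-1) \<odot>\<^bsub>V\<^esub> p = \<zero>\<^bsub>V\<^esub>"
      using \<open>x' = \<zero>\<^bsub>V\<^esub>\<close> unfolding x'_def residual_def p_def .
    moreover have "(-1) \<odot>\<^bsub>V\<^esub> p = \<ominus>\<^bsub>V\<^esub> p"
      using smult_minus_1[OF p] by (simp add: class_ring_simps)
    ultimately have "\<ominus>\<^bsub>V\<^esub> (\<ominus>\<^bsub>V\<^esub> p) = x" using p x by (intro minus_equality) auto
    then show ?thesis using p by (simp add: p_def)
  qed
  then show ?thesis using b unfolding orthonormal_frame_def by auto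
qed

end

text \<open>
  The map \<open>x \<mapsto> \<Sum>\<^sub>i \<omega>(x, b\<^sub>i) h\<^sub>i\<close> preserves the forms because both sides are computed by the same coordinates.
\<close>

lemma isometry_from_frame:
  assumes X: "is_cobj X" and Y: "is_cobj Y"
    and b: "orthonormal_frame X d b" and h: "orthonormal_family Y d h"
  shows "\<exists>g\<in>chom X Y. \<forall>i<d. g (b i) = h i"
proof -
  interpret X: quadratic_space "fst X" "snd X" using X is_cobj_iff_quadratic_space by blast
  interpret Y: quadratic_space "fst Y" "snd Y" using Y is_cobj_iff_quadratic_space by blast
  have bc: "b \<in> {..<d} \<rightarrow> carrier (fst X)" and bo: "orthonormal_family (fst X, snd X) d b"
    using b by (simp_all add: orthonormal_frame_def orthonormal_family_def)
  have hc: "h \<in> {..<d} \<rightarrow> carrier (fst Y)" and ho: "orthonormal_family (fst Y, snd Y) d h"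
    using h by (simp_all add: orthonormal_family_def)
  define g0 where "g0 x = lincomb_family (fst Y) (\<lambda>i. snd X x (b i)) h {..<d}" for x
  have g0c: "g0 x \<in> carrier (fst Y)" for x
    unfolding g0_def by (rule lincomb_family_closed[OF Y.is_module hc])
  define g where "g = (\<lambda>x\<in>carrier (fst X). g0 x)"
  have add: "g0 (x \<oplus>\<^bsub>fst X\<^esub> y) = g0 x \<oplus>\<^bsub>fst Y\<^esub> g0 y"
    if "x \<in> carrier (fst X)" "y \<in> carrier (fst X)" for x y
    unfolding g0_def lincomb_family_add[OF Y.is_module hc finite_lessThan, symmetric]
    using that bc hc by (intro lincomb_family_cong[OF Y.is_module]) (auto simp: X.form_add Pi_iff)
  have smult: "g0 (a \<odot>\<^bsub>fst X\<^esub> x) = a \<odot>\<^bsub>fst Y\<^esub> g0 x" if "x \<in> carrier (fst X)" for a x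
    unfolding g0_def lincomb_family_smult[OF Y.is_module hc finite_lessThan, symmetric]
    using that bc hc by (intro lincomb_family_cong[OF Y.is_module]) (auto simp: X.form_smult Pi_iff)
  have isom: "snd Y (g0 x) (g0 y) = snd X x y" if xy: "x \<in> carrier (fst X)" "y \<in> carrier (fst X)" for x y
  proof -
    have "snd Y (g0 x) (g0 y) = (\<Sum>i<d. snd X x (b i) * snd Y (h i) (g0 y))"
      unfolding g0_def[of x] using g0c hc by (intro Y.form_lincomb) auto
    also have "\<dots> = (\<Sum>i<d. snd X x (b i) * snd X (b i) y)"
    proof (intro sum.cong refl arg_cong2[of _ _ _ _ "(*)"])
      fix i assume "i \<in> {..<d}"
      then have i: "i < d" "h i \<in> carrier (fst Y)" "b i \<in> carrier (fst X)" using hc bc by auto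
      have "snd Y (h i) (g0 y) = snd Y (g0 y) (h i)" using Y.form_sym g0c i by blast
      also have "\<dots> = snd X y (b i)"
        unfolding g0_def using Y.form_lincomb_orthonormal[OF ho i(1)] by simp
      finally show "snd Y (h i) (g0 y) = snd X (b i) y" using X.form_sym i xy by simp
    qed
    also have "\<dots> = snd X (lincomb_family (fst X) (\<lambda>i. snd X x (b i)) b {..<d}) y"
      using bc xy by (intro X.form_lincomb[symmetric]) auto
    finally show ?thesis using b xy unfolding orthonormal_frame_def by simp
  qed
  have "g0 (b i) = h i" if "i < d" for i
  proof -
    have "g0 (b i) = lincomb_family (fst Y) (\<lambda>j. if j = i then 1 else 0) h {..<d}"
      unfolding g0_def using hc bo that
      by (intro lincomb_family_cong[OF Y.is_module]) (auto simp: orthonormal_family_def)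
    also have "\<dots> = 1 \<odot>\<^bsub>fst Y\<^esub> h i"
      using that by (intro lincomb_family_single[OF Y.is_module hc]) auto
    also have "\<dots> = h i" using hc that Y.smult_one by auto
    finally show ?thesis .
  qed
  then have "\<forall>i<d. g (b i) = h i" using bc unfolding g_def by auto
  moreover have "g \<in> chom X Y"
    using add smult isom g0c unfolding chom_def module_hom_def g_def by auto
  ultimately show ?thesis by blast
qed

section \<open>Quotients, free spaces and tensor powers\<close>

lemma mod_homI:
  assumes "Module.module class_ring V" "Module.module class_ring W" "f \<in> module_hom class_ring V W"
  shows "mod_hom class_ring V W f"
  using assms by (simp add: mod_hom_def mod_hom_axioms_def)

lemma submodule_vimage:
  fixes f :: "'a \<Rightarrow> 'b" and V :: "'a cvs" and W :: "'b cvs"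
  assumes V: "Module.module class_ring V" and W: "Module.module class_ring W"
    and f: "f \<in> module_hom class_ring V W" and S: "submodule class_ring S W"
  shows "submodule class_ring {x\<in>carrier V. f x \<in> S} V"
proof -
  interpret V: Module.module "class_ring :: complex ring" V by (rule V)
  interpret W: Module.module "class_ring :: complex ring" W by (rule W)
  interpret f: mod_hom "class_ring :: complex ring" V W f by (rule mod_homI[OF V W f])
  interpret S: submodule "class_ring :: complex ring" S W by (rule S)
  show ?thesis
  proof (rule submodule.intro[OF V])
    fix x y assume "x \<in> {x\<in>carrier V. f x \<in> S}" "y \<in> {x\<in>carrier V. f x \<in> S}"
    then show "x \<oplus>\<^bsub>V\<^esub> y \<in> {x\<in>carrier V. f x \<in> S}"
      using S.m_closed f.f_add by auto
  next
    fix a :: complex and x assume "x \<in> {x\<in>carrier V. f x \<in> S}"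
    then show "a \<odot>\<^bsub>V\<^esub> x \<in> {x\<in>carrier V. f x \<in> S}"
      using S.smult_closed f.f_smult by auto
  next
    have "f \<zero>\<^bsub>V\<^esub> = \<zero>\<^bsub>W\<^esub>" by (rule f.f0_is_0)
    then show "\<zero>\<^bsub>V\<^esub> \<in> {x\<in>carrier V. f x \<in> S}" using S.zero_closed by simp
  qed auto
qed

text \<open>
  The module laws are transported along \<open>f\<close>. The zero of \<open>W\<close> is not determined by its other operations until
  \<open>W\<close> is known to be a module, hence the last assumption.
\<close>

lemma module_of_surjective_hom:
  fixes f :: "'a \<Rightarrow> 'b" and V :: "'a cvs" and W :: "'b cvs"
  assumes V: "Module.module class_ring V" and f: "f \<in> module_hom class_ring V W"
    and surj: "f ` carrier V = carrier W" and zero: "f \<zero>\<^bsub>V\<^esub> = \<zero>\<^bsub>W\<^esub>"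
  shows "Module.module class_ring W"
proof -
  interpret V: Module.module "class_ring :: complex ring" V by (rule V)
  have fc: "f x \<in> carrier W" if "x \<in> carrier V" for x using surj that by auto
  have add: "f x \<oplus>\<^bsub>W\<^esub> f y = f (x \<oplus>\<^bsub>V\<^esub> y)" if "x \<in> carrier V" "y \<in> carrier V" for x y
    using LinearCombinations.module_hom_add[OF f that] by simp
  have smult: "a \<odot>\<^bsub>W\<^esub> f x = f (a \<odot>\<^bsub>V\<^esub> x)" if "x \<in> carrier V" for a x
    using LinearCombinations.module_hom_smult[OF f _ that, of a] by simp
  have all: "(\<forall>w\<in>carrier W. P w) \<longleftrightarrow> (\<forall>x\<in>carrier V. P (f x))" for P
    unfolding surj[symmetric] by simp
  show ?thesis
  proof (rule module_criteria)
    show "cring (class_ring :: complex ring)" by (rule class_cring.is_cring)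
    show "\<forall>v\<in>carrier W. \<exists>w\<in>carrier W. v \<oplus>\<^bsub>W\<^esub> w = \<zero>\<^bsub>W\<^esub>"
      unfolding all
    proof
      fix x assume x: "x \<in> carrier V"
      then have "f x \<oplus>\<^bsub>W\<^esub> f (\<ominus>\<^bsub>V\<^esub> x) = \<zero>\<^bsub>W\<^esub>" using add[of x "\<ominus>\<^bsub>V\<^esub> x"] zero by (simp add: V.r_neg)
      then show "\<exists>w\<in>carrier W. f x \<oplus>\<^bsub>W\<^esub> w = \<zero>\<^bsub>W\<^esub>" using fc x by blast
    qed
    show "\<zero>\<^bsub>W\<^esub> \<in> carrier W" using fc zero V.zero_closed by metis
    show "\<forall>v w. v \<in> carrier W \<and> w \<in> carrier W \<longrightarrow> v \<oplus>\<^bsub>W\<^esub> w \<in> carrier W"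
      unfolding surj[symmetric] using add by auto
    show "\<forall>c v. c \<in> carrier class_ring \<and> v \<in> carrier W \<longrightarrow> c \<odot>\<^bsub>W\<^esub> v \<in> carrier W"
      unfolding surj[symmetric] using smult by auto
    show "\<forall>v w. v \<in> carrier W \<and> w \<in> carrier W \<longrightarrow> v \<oplus>\<^bsub>W\<^esub> w = w \<oplus>\<^bsub>W\<^esub> v"
      unfolding surj[symmetric] using add by (auto simp: V.a_comm)
    show "\<forall>v w x. v \<in> carrier W \<and> w \<in> carrier W \<and> x \<in> carrier W \<longrightarrow>
        v \<oplus>\<^bsub>W\<^esub> w \<oplus>\<^bsub>W\<^esub> x = v \<oplus>\<^bsub>W\<^esub> (w \<oplus>\<^bsub>W\<^esub> x)"
      unfolding surj[symmetric] using add by (auto simp: V.a_assoc)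
    show "\<forall>v\<in>carrier W. v \<oplus>\<^bsub>W\<^esub> \<zero>\<^bsub>W\<^esub> = v"
      unfolding all zero[symmetric] using add by auto
    show "\<forall>a b v. a \<in> carrier class_ring \<and> b \<in> carrier class_ring \<and> v \<in> carrier W \<longrightarrow>
        (a \<otimes>\<^bsub>class_ring\<^esub> b) \<odot>\<^bsub>W\<^esub> v = a \<odot>\<^bsub>W\<^esub> (b \<odot>\<^bsub>W\<^esub> v)"
      unfolding surj[symmetric] using smult by (auto simp: V.smult_assoc1[simplified])
    show "\<forall>v\<in>carrier W. \<one>\<^bsub>class_ring\<^esub> \<odot>\<^bsub>W\<^esub> v = v"
      unfolding all using smult V.smult_one by auto
    show "\<forall>a b v. a \<in> carrier class_ring \<and> b \<in> carrier class_ring \<and> v \<in> carrier W \<longrightarrow>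
        (a \<oplus>\<^bsub>class_ring\<^esub> b) \<odot>\<^bsub>W\<^esub> v = a \<odot>\<^bsub>W\<^esub> v \<oplus>\<^bsub>W\<^esub> b \<odot>\<^bsub>W\<^esub> v"
      unfolding surj[symmetric] using smult add by (auto simp: V.smult_l_distr[simplified])
    show "\<forall>a v w. a \<in> carrier class_ring \<and> v \<in> carrier W \<and> w \<in> carrier W \<longrightarrow>
        a \<odot>\<^bsub>W\<^esub> (v \<oplus>\<^bsub>W\<^esub> w) = a \<odot>\<^bsub>W\<^esub> v \<oplus>\<^bsub>W\<^esub> a \<odot>\<^bsub>W\<^esub> w"
      unfolding surj[symmetric] using smult add by (auto simp: V.smult_r_distr[simplified])
  qed
qed

lemma mem_a_r_coset: "z \<in> W +>\<^bsub>V\<^esub> x \<longleftrightarrow> (\<exists>w\<in>W. z = w \<oplus>\<^bsub>V\<^esub> x)"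
  by (auto simp: a_r_coset_def')

lemma mem_set_add: "z \<in> A <+>\<^bsub>V\<^esub> B \<longleftrightarrow> (\<exists>a\<in>A. \<exists>b\<in>B. z = a \<oplus>\<^bsub>V\<^esub> b)"
  by (auto simp: set_add_def')

lemma a_r_cosetI: "w \<in> W \<Longrightarrow> w \<oplus>\<^bsub>V\<^esub> x \<in> W +>\<^bsub>V\<^esub> x"
  unfolding mem_a_r_coset by blast

lemma set_addI: "a \<in> A \<Longrightarrow> b \<in> B \<Longrightarrow> a \<oplus>\<^bsub>V\<^esub> b \<in> A <+>\<^bsub>V\<^esub> B"
  unfolding mem_set_add by blast

text \<open>
  Both the scalar multiplication of a quotient and the induced map between tensor powers are given by the
  left-hand side, the set of all sums of an element of \<open>S\<close> and an image of the coset. This computes it on representatives.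
\<close>

lemma submodule_set_add_image_coset:
  fixes f :: "'a \<Rightarrow> 'b" and V :: "'a cvs" and W :: "'b cvs"
  assumes V: "Module.module class_ring V" and W: "Module.module class_ring W"
    and f: "f \<in> module_hom class_ring V W"
    and R: "submodule class_ring R V" and S: "submodule class_ring S W" and RS: "f ` R \<subseteq> S"
    and x: "x \<in> carrier V"
  shows "S <+>\<^bsub>W\<^esub> f ` (R +>\<^bsub>V\<^esub> x) = S +>\<^bsub>W\<^esub> f x"
proof (rule Set.set_eqI)
  interpret V: Module.module "class_ring :: complex ring" V by (rule V)
  interpret W: Module.module "class_ring :: complex ring" W by (rule W)
  interpret R: submodule "class_ring :: complex ring" R V by (rule R)
  interpret S: submodule "class_ring :: complex ring" S W by (rule S)
  have fx: "f x \<in> carrier W" using LinearCombinations.module_hom_closed[OF f] x by auto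
  fix z
  show "z \<in> S <+>\<^bsub>W\<^esub> f ` (R +>\<^bsub>V\<^esub> x) \<longleftrightarrow> z \<in> S +>\<^bsub>W\<^esub> f x"
  proof
    assume "z \<in> S <+>\<^bsub>W\<^esub> f ` (R +>\<^bsub>V\<^esub> x)"
    then obtain s r where sr: "s \<in> S" "r \<in> R" "z = s \<oplus>\<^bsub>W\<^esub> f (r \<oplus>\<^bsub>V\<^esub> x)"
      by (auto simp: mem_set_add mem_a_r_coset)
    moreover have "r \<in> carrier V" "f r \<in> S" "s \<in> carrier W" "f r \<in> carrier W"
      using sr R.subset S.subset RS by auto
    ultimately have "z = (s \<oplus>\<^bsub>W\<^esub> f r) \<oplus>\<^bsub>W\<^esub> f x"
      using x fx by (simp add: LinearCombinations.module_hom_add[OF f] W.a_assoc)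
    then show "z \<in> S +>\<^bsub>W\<^esub> f x"
      using \<open>f r \<in> S\<close> sr by (auto simp: mem_a_r_coset)
  next
    assume "z \<in> S +>\<^bsub>W\<^esub> f x"
    then obtain s where "s \<in> S" "z = s \<oplus>\<^bsub>W\<^esub> f x" by (auto simp: mem_a_r_coset)
    moreover have "x \<in> R +>\<^bsub>V\<^esub> x"
      unfolding mem_a_r_coset using R.zero_closed x by (intro bexI[of _ "\<zero>\<^bsub>V\<^esub>"]) simp_all
    ultimately show "z \<in> S <+>\<^bsub>W\<^esub> f ` (R +>\<^bsub>V\<^esub> x)"
      unfolding mem_set_add by blast
  qed
qed

context
  fixes V :: "'v cvs" and W :: "'v set"
  assumes V: "Module.module class_ring V" and W: "submodule class_ring W V"
begin

interpretation V: Module.module "class_ring :: complex ring" V by (rule V)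
interpretation W: submodule "class_ring :: complex ring" W V by (rule W)

lemma coset_of_member:
  assumes "w \<in> W" shows "W +>\<^bsub>V\<^esub> w = W"
proof (rule Set.set_eqI)
  fix z
  have wc: "w \<in> carrier V" using assms W.subset by auto
  have neg: "\<ominus>\<^bsub>V\<^esub> w \<in> W"
  proof -
    have "(-1) \<odot>\<^bsub>V\<^esub> w \<in> W" using assms by (intro W.smult_closed) auto
    moreover have "(-1) \<odot>\<^bsub>V\<^esub> w = \<ominus>\<^bsub>V\<^esub> w"
      using V.smult_minus_1[OF wc] by (simp add: class_ring_simps)
    ultimately show ?thesis by (simp only:)
  qed
  show "z \<in> W +>\<^bsub>V\<^esub> w \<longleftrightarrow> z \<in> W"
  proof
    assume z: "z \<in> W"
    then have "z = (z \<oplus>\<^bsub>V\<^esub> \<ominus>\<^bsub>V\<^esub> w) \<oplus>\<^bsub>V\<^esub> w"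
      using wc W.subset by (auto simp: V.a_assoc V.l_neg)
    then show "z \<in> W +>\<^bsub>V\<^esub> w" using neg z by (auto simp: mem_a_r_coset)
  qed (use assms in \<open>auto simp: mem_a_r_coset\<close>)
qed

lemma coset_hom: "(\<lambda>x. W +>\<^bsub>V\<^esub> x) \<in> module_hom class_ring V (quotient_cvs V W)"
proof -
  have add: "W +>\<^bsub>V\<^esub> (x \<oplus>\<^bsub>V\<^esub> y) = (W +>\<^bsub>V\<^esub> x) <+>\<^bsub>V\<^esub> (W +>\<^bsub>V\<^esub> y)"
    if xy: "x \<in> carrier V" "y \<in> carrier V" for x y
  proof (rule Set.set_eqI)
    fix z
    have "(w \<oplus>\<^bsub>V\<^esub> x) \<oplus>\<^bsub>V\<^esub> (w' \<oplus>\<^bsub>V\<^esub> y) = (w \<oplus>\<^bsub>V\<^esub> w') \<oplus>\<^bsub>V\<^esub> (x \<oplus>\<^bsub>V\<^esub> y)" if "w \<in> W" "w' \<in> W" for w w'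
      using that xy W.subset by (auto simp: V.a_ac subset_iff)
    note eq = this
    show "z \<in> W +>\<^bsub>V\<^esub> (x \<oplus>\<^bsub>V\<^esub> y) \<longleftrightarrow> z \<in> (W +>\<^bsub>V\<^esub> x) <+>\<^bsub>V\<^esub> (W +>\<^bsub>V\<^esub> y)"
    proof
      assume "z \<in> W +>\<^bsub>V\<^esub> (x \<oplus>\<^bsub>V\<^esub> y)"
      then obtain w where w: "w \<in> W" "z = w \<oplus>\<^bsub>V\<^esub> (x \<oplus>\<^bsub>V\<^esub> y)" by (auto simp: mem_a_r_coset)
      then have "z = (w \<oplus>\<^bsub>V\<^esub> x) \<oplus>\<^bsub>V\<^esub> (\<zero>\<^bsub>V\<^esub> \<oplus>\<^bsub>V\<^esub> y)"
        using eq[OF w(1) W.zero_closed] W.subset by auto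
      then show "z \<in> (W +>\<^bsub>V\<^esub> x) <+>\<^bsub>V\<^esub> (W +>\<^bsub>V\<^esub> y)"
        using w(1) W.zero_closed by (simp only:) (intro set_addI a_r_cosetI)
    next
      assume "z \<in> (W +>\<^bsub>V\<^esub> x) <+>\<^bsub>V\<^esub> (W +>\<^bsub>V\<^esub> y)"
      then obtain w w' where "w \<in> W" "w' \<in> W" "z = (w \<oplus>\<^bsub>V\<^esub> x) \<oplus>\<^bsub>V\<^esub> (w' \<oplus>\<^bsub>V\<^esub> y)"
        unfolding mem_set_add mem_a_r_coset Bex_def by blast
      then show "z \<in> W +>\<^bsub>V\<^esub> (x \<oplus>\<^bsub>V\<^esub> y)"
        by (simp only: eq) (intro a_r_cosetI W.m_closed)
    qed
  qed
  have smult: "W +>\<^bsub>V\<^esub> (a \<odot>\<^bsub>V\<^esub> x) = W <+>\<^bsub>V\<^esub> (\<lambda>x. a \<odot>\<^bsub>V\<^esub> x) ` (W +>\<^bsub>V\<^esub> x)"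
    if "x \<in> carrier V" for a x
  proof (rule submodule_set_add_image_coset[symmetric, OF V V _ W W _ that])
    show "(\<lambda>x. a \<odot>\<^bsub>V\<^esub> x) \<in> module_hom class_ring V V"
      by (auto simp: module_hom_def V.smult_r_distr[simplified] V.smult_assoc1[simplified, symmetric] mult.commute)
    show "(\<lambda>x. a \<odot>\<^bsub>V\<^esub> x) ` W \<subseteq> W" by auto
  qed
  show ?thesis
    using add smult V.a_rcosetsI[OF W.subset]
    by (auto simp: module_hom_def quotient_cvs_def)
qed

lemma carrier_quotient: "carrier (quotient_cvs V W) = (\<lambda>x. W +>\<^bsub>V\<^esub> x) ` carrier V"
  unfolding quotient_cvs_def A_RCOSETS_def' by auto

lemma module_quotient: "Module.module class_ring (quotient_cvs V W)"
proof (rule module_of_surjective_hom[OF V coset_hom])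
  show "W +>\<^bsub>V\<^esub> \<zero>\<^bsub>V\<^esub> = \<zero>\<^bsub>quotient_cvs V W\<^esub>"
    using coset_of_member W.zero_closed by (simp add: quotient_cvs_def)
qed (simp add: carrier_quotient)

end

lemma mem_free_cvs: "c \<in> carrier (free_cvs B) \<longleftrightarrow> finite {b. c b \<noteq> 0} \<and> (\<forall>b. b \<notin> B \<longrightarrow> c b = 0)"
  by (auto simp: free_cvs_def)

lemma free_cvs_ops:
  "\<zero>\<^bsub>free_cvs B\<^esub> = (\<lambda>b. 0)" "c \<oplus>\<^bsub>free_cvs B\<^esub> c' = (\<lambda>b. c b + c' b)" "a \<odot>\<^bsub>free_cvs B\<^esub> c = (\<lambda>b. a * c b)"
  by (simp_all add: free_cvs_def)

lemma finite_support_add: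
  fixes c c' :: "'a \<Rightarrow> complex"
  assumes "finite {b. c b \<noteq> 0}" "finite {b. c' b \<noteq> 0}"
  shows "finite {b. c b + c' b \<noteq> 0}"
  using finite_UnI[OF assms] by (rule rev_finite_subset) auto

lemma module_free_cvs: "Module.module class_ring (free_cvs B)"
proof (rule module_criteria)
  show "cring (class_ring :: complex ring)" by (rule class_cring.is_cring)
  show "\<forall>v\<in>carrier (free_cvs B). \<exists>w\<in>carrier (free_cvs B). v \<oplus>\<^bsub>free_cvs B\<^esub> w = \<zero>\<^bsub>free_cvs B\<^esub>"
  proof
    fix v assume "v \<in> carrier (free_cvs B)"
    then show "\<exists>w\<in>carrier (free_cvs B). v \<oplus>\<^bsub>free_cvs B\<^esub> w = \<zero>\<^bsub>free_cvs B\<^esub>"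
      by (intro bexI[of _ "\<lambda>b. - v b"]) (simp_all add: mem_free_cvs free_cvs_ops)
  qed
qed (simp_all add: mem_free_cvs free_cvs_ops algebra_simps finite_support_add)

lemma free_basis_mem: "b \<in> B \<Longrightarrow> free_basis b \<in> carrier (free_cvs B)"
  by (auto simp: mem_free_cvs free_basis_def)

text \<open>
  Basis elements span: induction on the support, which loses a point when one coefficient is set to zero.
\<close>

lemma free_basis_submodule:
  assumes S: "submodule class_ring S (free_cvs B)" and B: "\<And>b. b \<in> B \<Longrightarrow> free_basis b \<in> S"
  shows "S = carrier (free_cvs B)"
proof
  interpret S: submodule "class_ring :: complex ring" S "free_cvs B" by (rule S)
  show "S \<subseteq> carrier (free_cvs B)" by (rule S.subset)
  have "c \<in> S" if "finite A" "{b. c b \<noteq> 0} = A" "A \<subseteq> B" for c A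
    using that
  proof (induction A arbitrary: c rule: finite_induct)
    case empty
    then have "c = \<zero>\<^bsub>free_cvs B\<^esub>" by (auto simp: free_cvs_def)
    then show ?case using S.zero_closed by simp
  next
    case (insert b A)
    have "c(b := 0) \<in> S" using insert by (intro insert.IH) auto
    moreover have "c b \<odot>\<^bsub>free_cvs B\<^esub> free_basis b \<in> S"
      using insert B by (intro S.smult_closed) auto
    ultimately have "c(b := 0) \<oplus>\<^bsub>free_cvs B\<^esub> (c b \<odot>\<^bsub>free_cvs B\<^esub> free_basis b) \<in> S"
      by (rule S.m_closed)
    also have "c(b := 0) \<oplus>\<^bsub>free_cvs B\<^esub> (c b \<odot>\<^bsub>free_cvs B\<^esub> free_basis b) = c"
      by (auto simp: free_cvs_def free_basis_def)
    finally show ?case .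
  qed
  then show "carrier (free_cvs B) \<subseteq> S" by (auto simp: free_cvs_def)
qed

text \<open>
  The sum over the fibre may be taken inside any finite set containing the support. One such set
  serves several coefficient functions at once, which gives additivity.
\<close>

lemma free_map_eq_sum:
  assumes "finite A" "{b. c b \<noteq> 0} \<subseteq> A"
  shows "free_map f c y = (\<Sum>b | b \<in> A \<and> f b = y. c b)"
  unfolding free_map_def using assms by (intro sum.mono_neutral_left) auto

lemma free_map_basis: "free_map f (free_basis b) = free_basis (f b)"
proof
  fix y
  have "free_map f (free_basis b) y = (\<Sum>b' | b' \<in> {b} \<and> f b' = y. free_basis b b')"
    by (intro free_map_eq_sum) (auto simp: free_basis_def)
  also have "\<dots> = free_basis (f b) y"
  proof (cases "y = f b")
    case True
    then have "{b'. b' \<in> {b} \<and> f b' = y} = {b}" by auto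
    then show ?thesis using True by (simp add: free_basis_def)
  next
    case False
    then have "{b'. b' \<in> {b} \<and> f b' = y} = {}" by auto
    then show ?thesis using False by (simp add: free_basis_def)
  qed
  finally show "free_map f (free_basis b) y = free_basis (f b) y" .
qed

lemma free_map_hom:
  assumes f: "f \<in> B \<rightarrow> C"
  shows "free_map f \<in> module_hom class_ring (free_cvs B) (free_cvs C)"
proof -
  have "free_map f c \<in> carrier (free_cvs C)" if c: "finite {b. c b \<noteq> 0}" "{b. c b \<noteq> 0} \<subseteq> B" for c
  proof -
    have "y \<in> f ` {b. c b \<noteq> 0}" if "free_map f c y \<noteq> 0" for y
    proof -
      have "{b. c b \<noteq> 0 \<and> f b = y} \<noteq> {}"
        using that unfolding free_map_def by (metis sum.empty)
      then show ?thesis by auto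
    qed
    then have sub: "{y. free_map f c y \<noteq> 0} \<subseteq> f ` {b. c b \<noteq> 0}" by blast
    have "finite {y. free_map f c y \<noteq> 0}" using c(1) by (intro finite_subset[OF sub]) simp
    moreover have "f ` {b. c b \<noteq> 0} \<subseteq> C" using f c by auto
    ultimately show ?thesis using sub by (simp add: free_cvs_def)
  qed
  moreover have "free_map f (\<lambda>b. c b + c' b) = (\<lambda>y. free_map f c y + free_map f c' y)"
    if "finite {b. c b \<noteq> 0}" "finite {b. c' b \<noteq> 0}" for c c'
  proof
    fix y
    define A where "A = {b. c b \<noteq> 0} \<union> {b. c' b \<noteq> 0}"
    have "finite A" "{b. c b \<noteq> 0} \<subseteq> A" "{b. c' b \<noteq> 0} \<subseteq> A" "{b. c b + c' b \<noteq> 0} \<subseteq> A"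
      using that unfolding A_def by auto
    then show "free_map f (\<lambda>b. c b + c' b) y = free_map f c y + free_map f c' y"
      by (simp add: free_map_eq_sum[of A] sum.distrib)
  qed
  moreover have "free_map f (\<lambda>b. a * c b) = (\<lambda>y. a * free_map f c y)" if "finite {b. c b \<noteq> 0}" for a c
    using that by (intro ext) (simp add: free_map_eq_sum[of "{b. c b \<noteq> 0}"] sum_distrib_left Collect_mono)
  ultimately show ?thesis
    unfolding module_hom_def by (auto simp: free_cvs_def)
qed


definition tensor_relators :: "nat \<Rightarrow> 'v cvs \<Rightarrow> ('v list \<Rightarrow> complex) set" where
  "tensor_relators n V =
     {(\<lambda>ys. free_basis (xs[i := x \<oplus>\<^bsub>V\<^esub> y]) ys
            - free_basis (xs[i := x]) ys - free_basis (xs[i := y]) ys) | xs i x y.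
        xs \<in> tuples n V \<and> i < n \<and> x \<in> carrier V \<and> y \<in> carrier V} \<union>
      {(\<lambda>ys. free_basis (xs[i := a \<odot>\<^bsub>V\<^esub> x]) ys - a * free_basis (xs[i := x]) ys) | xs i a x.
        xs \<in> tuples n V \<and> i < n \<and> x \<in> carrier V}"

definition tensor_class :: "nat \<Rightarrow> 'v cvs \<Rightarrow> ('v list \<Rightarrow> complex) \<Rightarrow> ('v list \<Rightarrow> complex) set" where
  "tensor_class n V c = tensor_relations n V +>\<^bsub>free_cvs (tuples n V)\<^esub> c"

definition pure_tensor :: "nat \<Rightarrow> 'v cvs \<Rightarrow> 'v list \<Rightarrow> ('v list \<Rightarrow> complex) set" where
  "pure_tensor n V xs = tensor_class n V (free_basis xs)"

lemma tensor_relations_eq: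
  "tensor_relations n V = LinearCombinations.module.span class_ring (free_cvs (tuples n V)) (tensor_relators n V)"
  unfolding tensor_relations_def tensor_relators_def ..

lemma tuples_update: "xs \<in> tuples n V \<Longrightarrow> x \<in> carrier V \<Longrightarrow> xs[i := x] \<in> tuples n V"
  unfolding tuples_def by (auto dest: set_update_subset_insert[THEN subsetD])

lemma submodule_diff:
  assumes "submodule class_ring S (free_cvs B)" "c \<in> S" "c' \<in> S"
  shows "(\<lambda>b. c b - c' b) \<in> S"
proof -
  interpret S: submodule "class_ring :: complex ring" S "free_cvs B" by (rule assms(1))
  have "c \<oplus>\<^bsub>free_cvs B\<^esub> ((-1) \<odot>\<^bsub>free_cvs B\<^esub> c') \<in> S"
    using assms by (intro S.m_closed S.smult_closed) auto
  then show ?thesis by (simp add: free_cvs_ops)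
qed

lemma carrier_submodule:
  fixes V :: "'v cvs"
  assumes "Module.module class_ring V" shows "submodule class_ring (carrier V) V"
proof -
  interpret V: Module.module "class_ring :: complex ring" V by (rule assms)
  show ?thesis by (rule submodule.intro[OF assms]) auto
qed

context
  fixes V :: "'v cvs"
  assumes V: "Module.module class_ring V"
begin

interpretation V: Module.module "class_ring :: complex ring" V by (rule V)

lemma tensor_relators_subset: "tensor_relators n V \<subseteq> carrier (free_cvs (tuples n V))"
proof -
  have smult: "(\<lambda>b. a * c b) \<in> carrier (free_cvs (tuples n V))"
    if "c \<in> carrier (free_cvs (tuples n V))" for a c
    using that by (auto simp: mem_free_cvs)
  have basis: "free_basis (xs[i := x]) \<in> carrier (free_cvs (tuples n V))"
    if "xs \<in> tuples n V" "x \<in> carrier V" for xs i x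
    using that by (intro free_basis_mem tuples_update)
  note diff = submodule_diff[OF carrier_submodule[OF module_free_cvs]]
  show ?thesis
    unfolding tensor_relators_def
  proof (intro Un_least subsetI; elim CollectE exE conjE; hypsubst)
    fix xs i x y assume "xs \<in> tuples n V" "x \<in> carrier V" "y \<in> carrier V"
    then show "(\<lambda>ys. free_basis (xs[i := x \<oplus>\<^bsub>V\<^esub> y]) ys - free_basis (xs[i := x]) ys - free_basis (xs[i := y]) ys)
        \<in> carrier (free_cvs (tuples n V))"
      by (intro diff basis V.a_closed)
  next
    fix xs i a x assume "xs \<in> tuples n V" "x \<in> carrier V"
    then show "(\<lambda>ys. free_basis (xs[i := a \<odot>\<^bsub>V\<^esub> x]) ys - a * free_basis (xs[i := x]) ys)
        \<in> carrier (free_cvs (tuples n V))"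
      by (intro diff basis smult V.smult_closed) simp_all
  qed
qed

lemma tensor_relations_submodule: "submodule class_ring (tensor_relations n V) (free_cvs (tuples n V))"
  unfolding tensor_relations_eq
  by (intro module.span_is_submodule module_free_cvs tensor_relators_subset)

lemma tensor_relators_subset_relations: "tensor_relators n V \<subseteq> tensor_relations n V"
  unfolding tensor_relations_eq
  by (intro module.in_own_span module_free_cvs tensor_relators_subset)

lemma module_tensor_power: "Module.module class_ring (tensor_power n V)"
  unfolding tensor_power_def by (intro module_quotient module_free_cvs tensor_relations_submodule)

lemma tensor_class_hom:
  "tensor_class n V \<in> module_hom class_ring (free_cvs (tuples n V)) (tensor_power n V)"
  unfolding tensor_power_def tensor_class_def[abs_def]
  by (intro coset_hom module_free_cvs tensor_relations_submodule)

lemma carrier_tensor_power: "carrier (tensor_power n V) = tensor_class n V ` carrier (free_cvs (tuples n V))"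
  unfolding tensor_power_def tensor_class_def[abs_def]
  by (intro carrier_quotient module_free_cvs tensor_relations_submodule)

lemma pure_tensor_mem: "xs \<in> tuples n V \<Longrightarrow> pure_tensor n V xs \<in> carrier (tensor_power n V)"
  unfolding pure_tensor_def carrier_tensor_power by (intro imageI free_basis_mem)

lemma tensor_class_relation: "c \<in> tensor_relations n V \<Longrightarrow> tensor_class n V c = \<zero>\<^bsub>tensor_power n V\<^esub>"
  unfolding tensor_class_def tensor_power_def
  using coset_of_member[OF module_free_cvs tensor_relations_submodule] by (simp add: quotient_cvs_def)

lemma tensor_class_add_relation:
  assumes r: "r \<in> tensor_relations n V" and c: "c \<in> carrier (free_cvs (tuples n V))"
  shows "tensor_class n V (\<lambda>ys. r ys + c ys) = tensor_class n V c"
proof -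
  interpret T: Module.module "class_ring :: complex ring" "tensor_power n V" by (rule module_tensor_power)
  interpret R: submodule "class_ring :: complex ring" "tensor_relations n V" "free_cvs (tuples n V)"
    by (rule tensor_relations_submodule)
  have "tensor_class n V (r \<oplus>\<^bsub>free_cvs (tuples n V)\<^esub> c) = tensor_class n V r \<oplus>\<^bsub>tensor_power n V\<^esub> tensor_class n V c"
    using r c R.subset by (intro LinearCombinations.module_hom_add[OF tensor_class_hom]) auto
  moreover have "tensor_class n V c \<in> carrier (tensor_power n V)" using c carrier_tensor_power by auto
  ultimately show ?thesis using r by (simp add: free_cvs_ops tensor_class_relation)
qed

text \<open>
  Multilinearity of \<open>\<otimes>\<close>: the defining relators are exactly the failures of this map to be linear.
\<close>

lemma pure_tensor_update_hom:
  assumes xs: "xs \<in> tuples n V" and i: "i < n"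
  shows "(\<lambda>x. pure_tensor n V (xs[i := x])) \<in> module_hom class_ring V (tensor_power n V)"
proof -
  note hom = tensor_class_hom[of n]
  have basis: "free_basis (xs[i := x]) \<in> carrier (free_cvs (tuples n V))" if "x \<in> carrier V" for x
    using xs that by (intro free_basis_mem tuples_update)
  have "pure_tensor n V (xs[i := x \<oplus>\<^bsub>V\<^esub> y]) =
      pure_tensor n V (xs[i := x]) \<oplus>\<^bsub>tensor_power n V\<^esub> pure_tensor n V (xs[i := y])"
    if xy: "x \<in> carrier V" "y \<in> carrier V" for x y
  proof -
    let ?r = "\<lambda>ys. free_basis (xs[i := x \<oplus>\<^bsub>V\<^esub> y]) ys - free_basis (xs[i := x]) ys - free_basis (xs[i := y]) ys"
    let ?c = "free_basis (xs[i := x]) \<oplus>\<^bsub>free_cvs (tuples n V)\<^esub> free_basis (xs[i := y])"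
    have r: "?r \<in> tensor_relations n V"
      by (rule subsetD[OF tensor_relators_subset_relations]) (use xs i xy in \<open>unfold tensor_relators_def, blast\<close>)
    have c: "?c \<in> carrier (free_cvs (tuples n V))"
      using carrier_submodule[OF module_free_cvs[of "tuples n V"]] basis xy by (meson submodule.m_closed)
    have "free_basis (xs[i := x \<oplus>\<^bsub>V\<^esub> y]) = (\<lambda>ys. ?r ys + ?c ys)"
      by (simp add: free_cvs_ops fun_eq_iff)
    then have "pure_tensor n V (xs[i := x \<oplus>\<^bsub>V\<^esub> y]) = tensor_class n V (\<lambda>ys. ?r ys + ?c ys)"
      unfolding pure_tensor_def by (rule arg_cong)
    also have "\<dots> = tensor_class n V ?c" by (rule tensor_class_add_relation[OF r c])
    also have "\<dots> = pure_tensor n V (xs[i := x]) \<oplus>\<^bsub>tensor_power n V\<^esub> pure_tensor n V (xs[i := y])"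
      unfolding pure_tensor_def using basis xy by (intro LinearCombinations.module_hom_add[OF hom]) auto
    finally show ?thesis .
  qed
  moreover have "pure_tensor n V (xs[i := a \<odot>\<^bsub>V\<^esub> x]) = a \<odot>\<^bsub>tensor_power n V\<^esub> pure_tensor n V (xs[i := x])"
    if x: "x \<in> carrier V" for a x
  proof -
    let ?r = "\<lambda>ys. free_basis (xs[i := a \<odot>\<^bsub>V\<^esub> x]) ys - a * free_basis (xs[i := x]) ys"
    let ?c = "a \<odot>\<^bsub>free_cvs (tuples n V)\<^esub> free_basis (xs[i := x])"
    have r: "?r \<in> tensor_relations n V"
      by (rule subsetD[OF tensor_relators_subset_relations]) (use xs i x in \<open>unfold tensor_relators_def, blast\<close>)
    have c: "?c \<in> carrier (free_cvs (tuples n V))"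
      using basis[OF x] by (auto simp: mem_free_cvs free_cvs_ops)
    have "free_basis (xs[i := a \<odot>\<^bsub>V\<^esub> x]) = (\<lambda>ys. ?r ys + ?c ys)"
      by (simp add: free_cvs_ops fun_eq_iff)
    then have "pure_tensor n V (xs[i := a \<odot>\<^bsub>V\<^esub> x]) = tensor_class n V (\<lambda>ys. ?r ys + ?c ys)"
      unfolding pure_tensor_def by (rule arg_cong)
    also have "\<dots> = tensor_class n V ?c" by (rule tensor_class_add_relation[OF r c])
    also have "\<dots> = a \<odot>\<^bsub>tensor_power n V\<^esub> pure_tensor n V (xs[i := x])"
      unfolding pure_tensor_def using basis x by (intro LinearCombinations.module_hom_smult[OF hom]) auto
    finally show ?thesis .
  qed
  moreover have "pure_tensor n V (xs[i := x]) \<in> carrier (tensor_power n V)" if "x \<in> carrier V" for x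
    using xs that by (intro pure_tensor_mem tuples_update)
  ultimately show ?thesis unfolding module_hom_def by auto
qed

lemma pure_tensors_span:
  assumes S: "submodule class_ring S (tensor_power n V)"
    and pure: "\<And>xs. xs \<in> tuples n V \<Longrightarrow> pure_tensor n V xs \<in> S"
  shows "S = carrier (tensor_power n V)"
proof
  show "S \<subseteq> carrier (tensor_power n V)" using S by (rule submodule.subset)
  have "{c \<in> carrier (free_cvs (tuples n V)). tensor_class n V c \<in> S} = carrier (free_cvs (tuples n V))"
    using pure unfolding pure_tensor_def
    by (intro free_basis_submodule submodule_vimage[OF module_free_cvs module_tensor_power tensor_class_hom S])
      (auto intro: free_basis_mem)
  then show "carrier (tensor_power n V) \<subseteq> S" unfolding carrier_tensor_power by blast
qed

text \<open>
  The generating property of \<open>B\<close> is stated as minimality, \<open>B\<close> lies in no proper subspace. This suits an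
  induction that replaces arbitrary entries by entries from \<open>B\<close> one position at a time: by multilinearity, the vectors
  that may stand in a given position form a subspace.
\<close>

lemma frame_tensors_span:
  assumes S: "submodule class_ring S (tensor_power n V)"
    and B: "B \<subseteq> carrier V" "\<And>N. submodule class_ring N V \<Longrightarrow> B \<subseteq> N \<Longrightarrow> N = carrier V"
    and pure: "\<And>xs. length xs = n \<Longrightarrow> set xs \<subseteq> B \<Longrightarrow> pure_tensor n V xs \<in> S"
  shows "S = carrier (tensor_power n V)"
proof -
  \<comment> \<open>The first \<open>k\<close> entries are arbitrary and the others lie in \<open>B\<close>.\<close>
  have "pure_tensor n V xs \<in> S" if "k \<le> n" "xs \<in> tuples n V" "\<forall>i<n. k \<le> i \<longrightarrow> xs ! i \<in> B" for k xs
    using that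
  proof (induction k arbitrary: xs)
    case 0
    then show ?case by (intro pure) (auto simp: tuples_def in_set_conv_nth)
  next
    case (Suc k)
    let ?f = "\<lambda>x. pure_tensor n V (xs[k := x])"
    have "submodule class_ring {x \<in> carrier V. ?f x \<in> S} V"
      using Suc.prems by (intro submodule_vimage[OF V module_tensor_power _ S] pure_tensor_update_hom) auto
    moreover have "B \<subseteq> {x \<in> carrier V. ?f x \<in> S}"
    proof
      fix x assume x: "x \<in> B"
      have len: "length xs = n" using Suc.prems by (simp add: tuples_def)
      have "?f x \<in> S"
      proof (rule Suc.IH)
        show "xs[k := x] \<in> tuples n V" using Suc.prems x B by (intro tuples_update) auto
        show "\<forall>i<n. k \<le> i \<longrightarrow> xs[k := x] ! i \<in> B"
        proof (intro allI impI)
          fix i assume "i < n" "k \<le> i"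
          then show "xs[k := x] ! i \<in> B" using x len Suc.prems(3) by (cases "i = k") auto
        qed
      qed (use Suc.prems in auto)
      then show "x \<in> {x \<in> carrier V. ?f x \<in> S}" using x B by auto
    qed
    ultimately have "{x \<in> carrier V. ?f x \<in> S} = carrier V" by (rule B(2))
    moreover have "xs ! k \<in> carrier V" using Suc.prems by (auto simp: tuples_def subset_iff)
    ultimately have "?f (xs ! k) \<in> S" by blast
    then show ?case by simp
  qed
  from this[of n] show ?thesis by (intro pure_tensors_span[OF S]) auto
qed

end

context
  fixes V W :: "'v cvs" and f :: "'v \<Rightarrow> 'v"
  assumes V: "Module.module class_ring V" and W: "Module.module class_ring W"
    and f: "f \<in> module_hom class_ring V W"
begin

interpretation V: Module.module "class_ring :: complex ring" V by (rule V)
interpretation W: Module.module "class_ring :: complex ring" W by (rule W)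

lemma map_tuples: "map f \<in> tuples n V \<rightarrow> tuples n W"
  using LinearCombinations.module_hom_closed[OF f] by (auto simp: tuples_def Pi_iff subset_iff)

lemma free_map_tuples_hom:
  "free_map (map f) \<in> module_hom class_ring (free_cvs (tuples n V)) (free_cvs (tuples n W))"
  by (intro free_map_hom map_tuples)

text \<open>
  A linear map turns relators into relators of the same form, and the preimage of the relations is a subspace.
\<close>

lemma free_map_relations: "free_map (map f) ` tensor_relations n V \<subseteq> tensor_relations n W"
proof -
  let ?F = "free_map (map f)"
  let ?V = "free_cvs (tuples n V)" and ?W = "free_cvs (tuples n W)"
  let ?S = "{c \<in> carrier ?V. ?F c \<in> tensor_relations n W}"
  have fc: "f x \<in> carrier W" if "x \<in> carrier V" for x
    using LinearCombinations.module_hom_closed[OF f] that by auto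
  interpret FV: Module.module "class_ring :: complex ring" ?V by (rule module_free_cvs)
  interpret F: mod_hom "class_ring :: complex ring" ?V ?W ?F
    by (intro mod_homI module_free_cvs free_map_tuples_hom)
  have basis: "free_basis (xs[i := x]) \<in> carrier ?V" if "xs \<in> tuples n V" "x \<in> carrier V" for xs i x
    using that by (intro free_basis_mem tuples_update)
  have diff: "?F (\<lambda>b. c b - c' b) = (\<lambda>b. ?F c b - ?F c' b)" if "c \<in> carrier ?V" "c' \<in> carrier ?V" for c c'
  proof -
    have "?F (c \<oplus>\<^bsub>?V\<^esub> (-1) \<odot>\<^bsub>?V\<^esub> c') = ?F c \<oplus>\<^bsub>?W\<^esub> (-1) \<odot>\<^bsub>?W\<^esub> ?F c'"
      using that F.f_add[of c "(-1) \<odot>\<^bsub>?V\<^esub> c'"] F.f_smult[of "-1" c'] FV.smult_closed[of "-1" c'] by simp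
    then show ?thesis by (simp add: free_cvs_ops)
  qed
  have diffc: "(\<lambda>b. c b - c' b) \<in> carrier ?V" if "c \<in> carrier ?V" "c' \<in> carrier ?V" for c c'
    using that by (intro submodule_diff[OF carrier_submodule[OF module_free_cvs]])
  have smult: "?F (\<lambda>b. a * c b) = (\<lambda>b. a * ?F c b)" if "c \<in> carrier ?V" for a c
    using that F.f_smult[of a c] by (simp add: free_cvs_ops)
  have smultc: "(\<lambda>b. a * c b) \<in> carrier ?V" if "c \<in> carrier ?V" for a c
    using that by (auto simp: mem_free_cvs)
  have "?F r \<in> tensor_relators n W" if "r \<in> tensor_relators n V" for r
    using that unfolding tensor_relators_def[of n V]
  proof (elim UnE CollectE exE conjE)
    fix xs i x y
    assume r: "r = (\<lambda>ys. free_basis (xs[i := x \<oplus>\<^bsub>V\<^esub> y]) ys - free_basis (xs[i := x]) ys - free_basis (xs[i := y]) ys)"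
      and h: "xs \<in> tuples n V" "i < n" "x \<in> carrier V" "y \<in> carrier V"
    have "?F r = (\<lambda>ys. free_basis ((map f xs)[i := f x \<oplus>\<^bsub>W\<^esub> f y]) ys
        - free_basis ((map f xs)[i := f x]) ys - free_basis ((map f xs)[i := f y]) ys)"
      unfolding r using h
      by (simp add: diff diffc basis V.a_closed free_map_basis map_update LinearCombinations.module_hom_add[OF f])
    moreover have "map f xs \<in> tuples n W" using map_tuples h by auto
    ultimately show ?thesis
      unfolding tensor_relators_def using h fc by blast
  next
    fix xs i a x
    assume r: "r = (\<lambda>ys. free_basis (xs[i := a \<odot>\<^bsub>V\<^esub> x]) ys - a * free_basis (xs[i := x]) ys)"
      and h: "xs \<in> tuples n V" "i < n" "x \<in> carrier V"
    have "?F r = (\<lambda>ys. free_basis ((map f xs)[i := a \<odot>\<^bsub>W\<^esub> f x]) ys - a * free_basis ((map f xs)[i := f x]) ys)"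
      unfolding r using h
      by (simp add: diff smult smultc basis V.smult_closed free_map_basis map_update
          LinearCombinations.module_hom_smult[OF f])
    moreover have "map f xs \<in> tuples n W" using map_tuples h by auto
    ultimately show ?thesis
      unfolding tensor_relators_def using h fc by blast
  qed
  then have "tensor_relators n V \<subseteq> ?S"
    using tensor_relators_subset[OF V] tensor_relators_subset_relations[OF W] by blast
  then have "tensor_relations n V \<subseteq> ?S"
    unfolding tensor_relations_eq[of n V]
    by (intro module.span_is_subset module_free_cvs
        submodule_vimage[OF module_free_cvs module_free_cvs free_map_tuples_hom tensor_relations_submodule[OF W]])
  then show ?thesis by blast
qed

lemma tensor_power_map_class:
  assumes "c \<in> carrier (free_cvs (tuples n V))"
  shows "tensor_power_map n W f (tensor_class n V c) = tensor_class n W (free_map (map f) c)"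
  unfolding tensor_power_map_def tensor_class_def
  by (intro submodule_set_add_image_coset module_free_cvs free_map_tuples_hom free_map_relations assms
      tensor_relations_submodule V W)

lemma tensor_power_map_pure:
  assumes "xs \<in> tuples n V"
  shows "tensor_power_map n W f (pure_tensor n V xs) = pure_tensor n W (map f xs)"
  unfolding pure_tensor_def using assms
  by (simp add: tensor_power_map_class free_basis_mem free_map_basis)

text \<open>
  All elements are classes of elements of the free space, where the map is \<open>free_map (map f)\<close>.
\<close>

lemma tensor_power_map_hom:
  "tensor_power_map n W f \<in> module_hom class_ring (tensor_power n V) (tensor_power n W)"
proof -
  let ?V = "free_cvs (tuples n V)" and ?W = "free_cvs (tuples n W)" and ?F = "free_map (map f)"
  let ?T = "tensor_power_map n W f"
  interpret FV: Module.module "class_ring :: complex ring" ?V by (rule module_free_cvs)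
  have Fc: "?F c \<in> carrier ?W" if "c \<in> carrier ?V" for c
    using LinearCombinations.module_hom_closed[OF free_map_tuples_hom] that by auto
  note homV = tensor_class_hom[OF V, of n] and homW = tensor_class_hom[OF W, of n]
  have "?T (tensor_class n V c \<oplus>\<^bsub>tensor_power n V\<^esub> tensor_class n V c') =
      ?T (tensor_class n V c) \<oplus>\<^bsub>tensor_power n W\<^esub> ?T (tensor_class n V c')"
    if "c \<in> carrier ?V" "c' \<in> carrier ?V" for c c'
    using that Fc
    by (simp add: LinearCombinations.module_hom_add[OF homV, symmetric] tensor_power_map_class
        LinearCombinations.module_hom_add[OF free_map_tuples_hom] LinearCombinations.module_hom_add[OF homW])
  moreover have "?T (a \<odot>\<^bsub>tensor_power n V\<^esub> tensor_class n V c) =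
      a \<odot>\<^bsub>tensor_power n W\<^esub> ?T (tensor_class n V c)" if "c \<in> carrier ?V" for a c
  proof -
    have ac: "a \<odot>\<^bsub>?V\<^esub> c \<in> carrier ?V" using FV.smult_closed[of a c] that by simp
    have "a \<odot>\<^bsub>tensor_power n V\<^esub> tensor_class n V c = tensor_class n V (a \<odot>\<^bsub>?V\<^esub> c)"
      using LinearCombinations.module_hom_smult[OF homV _ that, of a] by simp
    also have "?T \<dots> = tensor_class n W (a \<odot>\<^bsub>?W\<^esub> ?F c)"
      using LinearCombinations.module_hom_smult[OF free_map_tuples_hom _ that, of a]
      by (simp add: tensor_power_map_class[OF ac])
    also have "\<dots> = a \<odot>\<^bsub>tensor_power n W\<^esub> ?T (tensor_class n V c)"
      using LinearCombinations.module_hom_smult[OF homW _ Fc[OF that], of a]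
      by (simp add: tensor_power_map_class[OF that])
    finally show ?thesis .
  qed
  moreover have "?T (tensor_class n V c) \<in> carrier (tensor_power n W)" if "c \<in> carrier ?V" for c
    using that Fc by (simp add: tensor_power_map_class carrier_tensor_power[OF W])
  ultimately show ?thesis
    unfolding module_hom_def carrier_tensor_power[OF V] by auto
qed

end

section \<open>Direct sums\<close>

lemma mem_direct_sum_cvs:
  "x \<in> carrier (direct_sum_cvs I V) \<longleftrightarrow>
     (\<forall>i\<in>I. x i \<in> carrier (V i)) \<and> x \<in> extensional I \<and> finite {i\<in>I. x i \<noteq> \<zero>\<^bsub>V i\<^esub>}"
  by (auto simp: direct_sum_cvs_def PiE_iff)

lemma direct_sum_cvs_ops:
  "\<zero>\<^bsub>direct_sum_cvs I V\<^esub> = (\<lambda>i\<in>I. \<zero>\<^bsub>V i\<^esub>)"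
  "x \<oplus>\<^bsub>direct_sum_cvs I V\<^esub> y = (\<lambda>i\<in>I. x i \<oplus>\<^bsub>V i\<^esub> y i)"
  "a \<odot>\<^bsub>direct_sum_cvs I V\<^esub> x = (\<lambda>i\<in>I. a \<odot>\<^bsub>V i\<^esub> x i)"
  by (simp_all add: direct_sum_cvs_def)

definition direct_sum_inj :: "'i set \<Rightarrow> ('i \<Rightarrow> 'v cvs) \<Rightarrow> 'i \<Rightarrow> 'v \<Rightarrow> 'i \<Rightarrow> 'v" where
  "direct_sum_inj I V i x = (\<lambda>j\<in>I. if j = i then x else \<zero>\<^bsub>V j\<^esub>)"

context
  fixes I :: "'i set" and V :: "'i \<Rightarrow> 'v cvs"
  assumes V: "\<And>i. i \<in> I \<Longrightarrow> Module.module class_ring (V i)"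
begin

text \<open>
  The laws of the components, in the form in which rewriting under \<open>\<lambda>i\<in>I\<close> can use them.
\<close>

lemma component_simps:
  assumes i: "i \<in> I"
  shows "\<zero>\<^bsub>V i\<^esub> \<in> carrier (V i)"
    and "a \<odot>\<^bsub>V i\<^esub> \<zero>\<^bsub>V i\<^esub> = \<zero>\<^bsub>V i\<^esub>"
    and "\<ominus>\<^bsub>V i\<^esub> \<zero>\<^bsub>V i\<^esub> = \<zero>\<^bsub>V i\<^esub>"
    and "x \<in> carrier (V i) \<Longrightarrow> a \<odot>\<^bsub>V i\<^esub> x \<in> carrier (V i)"
    and "x \<in> carrier (V i) \<Longrightarrow> \<zero>\<^bsub>V i\<^esub> \<oplus>\<^bsub>V i\<^esub> x = x"
    and "x \<in> carrier (V i) \<Longrightarrow> x \<oplus>\<^bsub>V i\<^esub> \<zero>\<^bsub>V i\<^esub> = x"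
    and "x \<in> carrier (V i) \<Longrightarrow> \<ominus>\<^bsub>V i\<^esub> x \<in> carrier (V i)"
    and "x \<in> carrier (V i) \<Longrightarrow> x \<oplus>\<^bsub>V i\<^esub> \<ominus>\<^bsub>V i\<^esub> x = \<zero>\<^bsub>V i\<^esub>"
    and "x \<in> carrier (V i) \<Longrightarrow> 1 \<odot>\<^bsub>V i\<^esub> x = x"
    and "x \<in> carrier (V i) \<Longrightarrow> (a * a') \<odot>\<^bsub>V i\<^esub> x = a \<odot>\<^bsub>V i\<^esub> (a' \<odot>\<^bsub>V i\<^esub> x)"
    and "x \<in> carrier (V i) \<Longrightarrow> (a + a') \<odot>\<^bsub>V i\<^esub> x = a \<odot>\<^bsub>V i\<^esub> x \<oplus>\<^bsub>V i\<^esub> a' \<odot>\<^bsub>V i\<^esub> x"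
    and "x \<in> carrier (V i) \<Longrightarrow> y \<in> carrier (V i) \<Longrightarrow> x \<oplus>\<^bsub>V i\<^esub> y \<in> carrier (V i)"
    and "x \<in> carrier (V i) \<Longrightarrow> y \<in> carrier (V i) \<Longrightarrow>
      a \<odot>\<^bsub>V i\<^esub> (x \<oplus>\<^bsub>V i\<^esub> y) = a \<odot>\<^bsub>V i\<^esub> x \<oplus>\<^bsub>V i\<^esub> a \<odot>\<^bsub>V i\<^esub> y"
    and "x \<in> carrier (V i) \<Longrightarrow> y \<in> carrier (V i) \<Longrightarrow> z \<in> carrier (V i) \<Longrightarrow>
      x \<oplus>\<^bsub>V i\<^esub> y \<oplus>\<^bsub>V i\<^esub> z = x \<oplus>\<^bsub>V i\<^esub> (y \<oplus>\<^bsub>V i\<^esub> z)"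
proof -
  interpret Module.module "class_ring :: complex ring" "V i" by (rule V[OF i])
  show "\<zero>\<^bsub>V i\<^esub> \<in> carrier (V i)" "a \<odot>\<^bsub>V i\<^esub> \<zero>\<^bsub>V i\<^esub> = \<zero>\<^bsub>V i\<^esub>" "\<ominus>\<^bsub>V i\<^esub> \<zero>\<^bsub>V i\<^esub> = \<zero>\<^bsub>V i\<^esub>"
    using smult_r_null[of a] by simp_all
  show "x \<in> carrier (V i) \<Longrightarrow> a \<odot>\<^bsub>V i\<^esub> x \<in> carrier (V i)" "x \<in> carrier (V i) \<Longrightarrow> 1 \<odot>\<^bsub>V i\<^esub> x = x"
    "x \<in> carrier (V i) \<Longrightarrow> (a * a') \<odot>\<^bsub>V i\<^esub> x = a \<odot>\<^bsub>V i\<^esub> (a' \<odot>\<^bsub>V i\<^esub> x)"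
    "x \<in> carrier (V i) \<Longrightarrow> (a + a') \<odot>\<^bsub>V i\<^esub> x = a \<odot>\<^bsub>V i\<^esub> x \<oplus>\<^bsub>V i\<^esub> a' \<odot>\<^bsub>V i\<^esub> x"
    "x \<in> carrier (V i) \<Longrightarrow> y \<in> carrier (V i) \<Longrightarrow>
      a \<odot>\<^bsub>V i\<^esub> (x \<oplus>\<^bsub>V i\<^esub> y) = a \<odot>\<^bsub>V i\<^esub> x \<oplus>\<^bsub>V i\<^esub> a \<odot>\<^bsub>V i\<^esub> y"
    using smult_one smult_assoc1[of a a' x] smult_l_distr[of a a' x] smult_r_distr[of a x y]
      smult_closed[of a x] by simp_all
qed (use module.axioms(2)[OF V[OF i]] in \<open>simp_all add: abelian_group.a_inv_closed abelian_group.r_neg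
      abelian_monoid.l_zero abelian_monoid.r_zero abelian_monoid.a_closed abelian_monoid.a_assoc abelian_group_def\<close>)

lemma component_add_commute:
  "i \<in> I \<Longrightarrow> x \<in> carrier (V i) \<Longrightarrow> y \<in> carrier (V i) \<Longrightarrow> x \<oplus>\<^bsub>V i\<^esub> y = y \<oplus>\<^bsub>V i\<^esub> x"
  using module.axioms(2)[OF V] by (simp add: abelian_group_def abelian_monoid.a_comm)

lemma module_direct_sum: "Module.module class_ring (direct_sum_cvs I V)"
proof (rule module_criteria)
  let ?S = "direct_sum_cvs I V"
  show "cring (class_ring :: complex ring)" by (rule class_cring.is_cring)
  show "\<forall>v w. v \<in> carrier ?S \<and> w \<in> carrier ?S \<longrightarrow> v \<oplus>\<^bsub>?S\<^esub> w \<in> carrier ?S"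
  proof (intro allI impI, elim conjE)
    fix v w assume vw: "v \<in> carrier ?S" "w \<in> carrier ?S"
    have "{i\<in>I. v i \<oplus>\<^bsub>V i\<^esub> w i \<noteq> \<zero>\<^bsub>V i\<^esub>} \<subseteq> {i\<in>I. v i \<noteq> \<zero>\<^bsub>V i\<^esub>} \<union> {i\<in>I. w i \<noteq> \<zero>\<^bsub>V i\<^esub>}"
      using vw by (auto simp: mem_direct_sum_cvs component_simps)
    then have "finite {i\<in>I. v i \<oplus>\<^bsub>V i\<^esub> w i \<noteq> \<zero>\<^bsub>V i\<^esub>}"
      by (rule finite_subset) (use vw in \<open>simp add: mem_direct_sum_cvs\<close>)
    then show "v \<oplus>\<^bsub>?S\<^esub> w \<in> carrier ?S"
      using vw by (simp add: mem_direct_sum_cvs direct_sum_cvs_ops component_simps cong: conj_cong)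
  qed
  show "\<forall>c v. c \<in> carrier class_ring \<and> v \<in> carrier ?S \<longrightarrow> c \<odot>\<^bsub>?S\<^esub> v \<in> carrier ?S"
  proof (intro allI impI, elim conjE)
    fix c :: complex and v assume v: "v \<in> carrier ?S"
    have "{i\<in>I. c \<odot>\<^bsub>V i\<^esub> v i \<noteq> \<zero>\<^bsub>V i\<^esub>} \<subseteq> {i\<in>I. v i \<noteq> \<zero>\<^bsub>V i\<^esub>}"
      by (auto simp: component_simps)
    then have "finite {i\<in>I. c \<odot>\<^bsub>V i\<^esub> v i \<noteq> \<zero>\<^bsub>V i\<^esub>}"
      by (rule finite_subset) (use v in \<open>simp add: mem_direct_sum_cvs\<close>)
    then show "c \<odot>\<^bsub>?S\<^esub> v \<in> carrier ?S"
      using v by (simp add: mem_direct_sum_cvs direct_sum_cvs_ops component_simps cong: conj_cong)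
  qed
  show "\<zero>\<^bsub>?S\<^esub> \<in> carrier ?S"
    by (simp add: mem_direct_sum_cvs direct_sum_cvs_ops component_simps cong: conj_cong)
  show "\<forall>v\<in>carrier ?S. \<exists>w\<in>carrier ?S. v \<oplus>\<^bsub>?S\<^esub> w = \<zero>\<^bsub>?S\<^esub>"
  proof
    fix v assume v: "v \<in> carrier ?S"
    define w where "w = (\<lambda>i\<in>I. \<ominus>\<^bsub>V i\<^esub> v i)"
    have "{i\<in>I. w i \<noteq> \<zero>\<^bsub>V i\<^esub>} \<subseteq> {i\<in>I. v i \<noteq> \<zero>\<^bsub>V i\<^esub>}"
      by (auto simp: w_def component_simps)
    then have "finite {i\<in>I. w i \<noteq> \<zero>\<^bsub>V i\<^esub>}"
      by (rule finite_subset) (use v in \<open>simp add: mem_direct_sum_cvs\<close>)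
    then have "w \<in> carrier ?S"
      using v by (simp add: mem_direct_sum_cvs w_def component_simps)
    moreover have "v \<oplus>\<^bsub>?S\<^esub> w = \<zero>\<^bsub>?S\<^esub>"
      using v by (auto simp: mem_direct_sum_cvs direct_sum_cvs_ops w_def component_simps intro!: restrict_ext)
    ultimately show "\<exists>w\<in>carrier ?S. v \<oplus>\<^bsub>?S\<^esub> w = \<zero>\<^bsub>?S\<^esub>" by blast
  qed
  show "\<forall>v\<in>carrier ?S. v \<oplus>\<^bsub>?S\<^esub> \<zero>\<^bsub>?S\<^esub> = v" "\<forall>v\<in>carrier ?S. \<one>\<^bsub>class_ring\<^esub> \<odot>\<^bsub>?S\<^esub> v = v"
    by (auto simp: mem_direct_sum_cvs direct_sum_cvs_ops component_simps intro!: extensionalityI[of _ I])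
  show "\<forall>v w. v \<in> carrier ?S \<and> w \<in> carrier ?S \<longrightarrow> v \<oplus>\<^bsub>?S\<^esub> w = w \<oplus>\<^bsub>?S\<^esub> v"
    by (auto simp: mem_direct_sum_cvs direct_sum_cvs_ops component_add_commute intro!: restrict_ext)
qed (auto simp: mem_direct_sum_cvs direct_sum_cvs_ops component_simps intro!: restrict_ext)

lemma direct_sum_inj_hom:
  assumes i: "i \<in> I"
  shows "direct_sum_inj I V i \<in> module_hom class_ring (V i) (direct_sum_cvs I V)"
proof -
  have "finite {j \<in> I. direct_sum_inj I V i x j \<noteq> \<zero>\<^bsub>V j\<^esub>}" for x
    by (rule finite_subset[of _ "{i}"]) (auto simp: direct_sum_inj_def)
  then have "direct_sum_inj I V i x \<in> carrier (direct_sum_cvs I V)" if "x \<in> carrier (V i)" for x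
    using that by (auto simp: mem_direct_sum_cvs direct_sum_inj_def component_simps)
  then show ?thesis
    unfolding module_hom_def
    by (auto simp: direct_sum_inj_def direct_sum_cvs_ops component_simps intro!: restrict_ext)
qed

text \<open>
  Such an \<open>x\<close> is the sum of its components in \<open>J\<close>; the induction splits off one component.
\<close>

lemma finitely_supported_mem:
  assumes S: "submodule class_ring S (direct_sum_cvs I V)" and "finite J" "J \<subseteq> I"
    and inj: "\<And>j x. j \<in> J \<Longrightarrow> x \<in> carrier (V j) \<Longrightarrow> direct_sum_inj I V j x \<in> S"
    and x: "x \<in> carrier (direct_sum_cvs I V)" "\<And>i. i \<in> I - J \<Longrightarrow> x i = \<zero>\<^bsub>V i\<^esub>"
  shows "x \<in> S"
  using assms(2,3) inj x
proof (induction J arbitrary: x rule: finite_induct)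
  case empty
  then have "x = \<zero>\<^bsub>direct_sum_cvs I V\<^esub>"
    by (auto simp: mem_direct_sum_cvs direct_sum_cvs_ops intro!: extensionalityI[of _ I])
  then show ?case using submodule.zero_closed[OF S] by simp
next
  case (insert j J)
  have j: "j \<in> I" "x j \<in> carrier (V j)" using insert.prems by (auto simp: mem_direct_sum_cvs)
  define x' where "x' = x(j := \<zero>\<^bsub>V j\<^esub>)"
  have zero: "\<zero>\<^bsub>V j\<^esub> \<in> carrier (V j)" by (rule component_simps(1)[OF j(1)])
  have "{i \<in> I. x' i \<noteq> \<zero>\<^bsub>V i\<^esub>} \<subseteq> {i \<in> I. x i \<noteq> \<zero>\<^bsub>V i\<^esub>}" by (auto simp: x'_def)
  then have "finite {i \<in> I. x' i \<noteq> \<zero>\<^bsub>V i\<^esub>}"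
    by (rule finite_subset) (use insert.prems in \<open>simp add: mem_direct_sum_cvs\<close>)
  then have x': "x' \<in> carrier (direct_sum_cvs I V)"
    using insert.prems(3) j zero by (auto simp: mem_direct_sum_cvs x'_def extensional_def)
  have "x' \<in> S"
  proof (rule insert.IH[OF _ _ x'])
    show "x' i = \<zero>\<^bsub>V i\<^esub>" if "i \<in> I - J" for i using that insert.prems(4) by (auto simp: x'_def)
  qed (use insert.prems in auto)
  moreover have "direct_sum_inj I V j (x j) \<in> S" using insert.prems j by auto
  ultimately have "x' \<oplus>\<^bsub>direct_sum_cvs I V\<^esub> direct_sum_inj I V j (x j) \<in> S"
    by (rule submodule.m_closed[OF S])
  also have "x' \<oplus>\<^bsub>direct_sum_cvs I V\<^esub> direct_sum_inj I V j (x j) = x"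
  proof (rule extensionalityI[of _ I])
    fix i assume "i \<in> I"
    then show "(x' \<oplus>\<^bsub>direct_sum_cvs I V\<^esub> direct_sum_inj I V j (x j)) i = x i"
      using insert.prems(3) j
      by (auto simp: direct_sum_cvs_ops direct_sum_inj_def x'_def component_simps mem_direct_sum_cvs)
  qed (use insert.prems(3) in \<open>auto simp: direct_sum_cvs_ops mem_direct_sum_cvs\<close>)
  finally show ?case .
qed

end

context
  fixes I :: "'i set" and V :: "'i \<Rightarrow> 'v cvs" and W :: "'i \<Rightarrow> 'w cvs" and f :: "'i \<Rightarrow> 'v \<Rightarrow> 'w"
  assumes V: "\<And>i. i \<in> I \<Longrightarrow> Module.module class_ring (V i)"
    and W: "\<And>i. i \<in> I \<Longrightarrow> Module.module class_ring (W i)"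
    and f: "\<And>i. i \<in> I \<Longrightarrow> f i \<in> module_hom class_ring (V i) (W i)"
begin

lemma component_hom_zero:
  assumes "i \<in> I" shows "f i \<zero>\<^bsub>V i\<^esub> = \<zero>\<^bsub>W i\<^esub>"
  using mod_hom.f0_is_0[OF mod_homI[OF V[OF assms] W[OF assms] f[OF assms]]] .

lemma direct_sum_map_hom:
  "(\<lambda>x. \<lambda>i\<in>I. f i (x i)) \<in> module_hom class_ring (direct_sum_cvs I V) (direct_sum_cvs I W)"
proof -
  have "(\<lambda>i\<in>I. f i (x i)) \<in> carrier (direct_sum_cvs I W)" if x: "x \<in> carrier (direct_sum_cvs I V)" for x
  proof -
    have "{i\<in>I. (\<lambda>i\<in>I. f i (x i)) i \<noteq> \<zero>\<^bsub>W i\<^esub>} \<subseteq> {i\<in>I. x i \<noteq> \<zero>\<^bsub>V i\<^esub>}"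
      using component_hom_zero by auto
    then have "finite {i\<in>I. (\<lambda>i\<in>I. f i (x i)) i \<noteq> \<zero>\<^bsub>W i\<^esub>}"
      by (rule finite_subset) (use x in \<open>simp add: mem_direct_sum_cvs\<close>)
    then show ?thesis
      using x LinearCombinations.module_hom_closed[OF f] by (auto simp: mem_direct_sum_cvs Pi_iff)
  qed
  then show ?thesis
    unfolding module_hom_def[of _ "direct_sum_cvs I V"]
    using LinearCombinations.module_hom_add[OF f] LinearCombinations.module_hom_smult[OF f]
    by (auto simp: mem_direct_sum_cvs direct_sum_cvs_ops intro!: restrict_ext)
qed

lemma direct_sum_map_inj:
  assumes "i \<in> I"
  shows "(\<lambda>j\<in>I. f j (direct_sum_inj I V i x j)) = direct_sum_inj I W i (f i x)"
  unfolding direct_sum_inj_def using component_hom_zero by (intro restrict_ext) auto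

end

section \<open>Basis tensors in direct sums of tensor powers\<close>

text \<open>
  The list \<open>js\<close> enumerates the summands that occur; \<open>b\<close> is the family of vectors that the letters stand for.
\<close>

definition word_tensor ::
    "'i set \<Rightarrow> ('i \<Rightarrow> nat) \<Rightarrow> 'i list \<Rightarrow> 'v cobj \<Rightarrow> (nat \<Rightarrow> 'v) \<Rightarrow> nat list \<Rightarrow> 'i \<Rightarrow> ('v list \<Rightarrow> complex) set"
  where
  "word_tensor I n js X b u = (let i = js ! hd u in
     direct_sum_inj I (\<lambda>i. tensor_power (n i) (fst X)) i (pure_tensor (n i) (fst X) (map b (tl u))))"

lemma is_cobj_module: "is_cobj X \<Longrightarrow> Module.module class_ring (fst X)"
  using is_cobj_iff_quadratic_space quadratic_space.is_module by blast

lemma chom_hom: "g \<in> chom X Y \<Longrightarrow> g \<in> module_hom class_ring (fst X) (fst Y)"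
  by (simp add: chom_def)

abbreviation tensor_sum ::
    "'i set \<Rightarrow> ('i \<Rightarrow> nat) \<Rightarrow> ('v, 'i \<Rightarrow> ('v list \<Rightarrow> complex) set) cmodule" where
  "tensor_sum I n \<equiv> direct_sum_cmodule I (\<lambda>i. tensor_cmodule (n i))"

lemma ob_tensor_sum: "ob (tensor_sum I n) X = direct_sum_cvs I (\<lambda>i. tensor_power (n i) (fst X))"
  by (simp add: direct_sum_cmodule_def tensor_cmodule_def)

lemma mor_tensor_sum: "mor (tensor_sum I n) X Y g = (\<lambda>x. \<lambda>i\<in>I. tensor_power_map (n i) (fst Y) g (x i))"
  by (simp add: direct_sum_cmodule_def tensor_cmodule_def)

lemma module_tensor_sum: "is_cobj X \<Longrightarrow> Module.module class_ring (ob (tensor_sum I n) X)"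
  unfolding ob_tensor_sum by (intro module_direct_sum module_tensor_power is_cobj_module)

lemma mor_tensor_sum_hom:
  "is_cobj X \<Longrightarrow> is_cobj Y \<Longrightarrow> g \<in> chom X Y \<Longrightarrow>
     mor (tensor_sum I n) X Y g \<in> module_hom class_ring (ob (tensor_sum I n) X) (ob (tensor_sum I n) Y)"
  unfolding ob_tensor_sum mor_tensor_sum
  by (intro direct_sum_map_hom module_tensor_power tensor_power_map_hom is_cobj_module chom_hom)

context
  fixes I :: "'i set" and n :: "'i \<Rightarrow> nat" and js :: "'i list"
  assumes js: "set js \<subseteq> I"
begin

lemma word_tuple:
  assumes "orthonormal_frame X d b" and u: "u \<in> words (map n js) d"
  shows "js ! hd u \<in> I" "map b (tl u) \<in> tuples (n (js ! hd u)) (fst X)" "set (tl u) \<subseteq> {..<d}"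
proof -
  from u obtain h w where hw: "u = h # w" "h < length js" "length w = n (js ! h)" "set w \<subseteq> {..<d}"
    unfolding words_def by auto
  moreover have "b ` {..<d} \<subseteq> carrier (fst X)"
    using assms(1) by (auto simp: orthonormal_frame_def orthonormal_family_def)
  ultimately show "js ! hd u \<in> I" "map b (tl u) \<in> tuples (n (js ! hd u)) (fst X)" "set (tl u) \<subseteq> {..<d}"
    using js by (auto simp: tuples_def)
qed

lemma word_tensor_mem:
  assumes X: "is_cobj X" and b: "orthonormal_frame X d b" and u: "u \<in> words (map n js) d"
  shows "word_tensor I n js X b u \<in> carrier (ob (tensor_sum I n) X)"
proof -
  note i = word_tuple[OF b u]
  have "direct_sum_inj I (\<lambda>i. tensor_power (n i) (fst X)) (js ! hd u)
      \<in> module_hom class_ring (tensor_power (n (js ! hd u)) (fst X)) (ob (tensor_sum I n) X)"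
    unfolding ob_tensor_sum
    by (intro direct_sum_inj_hom module_tensor_power is_cobj_module X i(1))
  then show ?thesis
    using pure_tensor_mem[OF is_cobj_module[OF X] i(2)]
    unfolding word_tensor_def Let_def module_hom_def by auto
qed

text \<open>
  A morphism that carries frame vectors to frame vectors acts on basis tensors through their words.
\<close>

lemma word_tensor_natural:
  assumes X: "is_cobj X" and Y: "is_cobj Y" and g: "g \<in> chom X Y"
    and b: "orthonormal_frame X d b" and u: "u \<in> words (map n js) d"
    and gb: "\<And>k. k < d \<Longrightarrow> g (b k) = b' (f k)"
  shows "mor (tensor_sum I n) X Y g (word_tensor I n js X b u) = word_tensor I n js Y b' (relabel f u)"
proof -
  note i = word_tuple[OF b u]
  let ?i = "js ! hd u"
  note mX = is_cobj_module[OF X] and mY = is_cobj_module[OF Y] and hg = chom_hom[OF g]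
  have "mor (tensor_sum I n) X Y g (word_tensor I n js X b u) =
      direct_sum_inj I (\<lambda>i. tensor_power (n i) (fst Y)) ?i
        (tensor_power_map (n ?i) (fst Y) g (pure_tensor (n ?i) (fst X) (map b (tl u))))"
    unfolding mor_tensor_sum word_tensor_def Let_def
    by (intro direct_sum_map_inj module_tensor_power tensor_power_map_hom mX mY hg i(1))
  also have "tensor_power_map (n ?i) (fst Y) g (pure_tensor (n ?i) (fst X) (map b (tl u))) =
      pure_tensor (n ?i) (fst Y) (map g (map b (tl u)))"
    by (rule tensor_power_map_pure[OF mX mY hg i(2)])
  also have "map g (map b (tl u)) = map b' (map f (tl u))"
    using gb i(3) by auto
  finally show ?thesis by (simp add: word_tensor_def Let_def relabel_def)
qed

text \<open>
  The basis tensors span the part of the direct sum that is supported on the summands in \<open>js\<close>: within one summand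
  by multilinearity, and over all of them since the support is finite.
\<close>

lemma word_tensors_span:
  assumes X: "is_cobj X" and b: "orthonormal_frame X d b"
    and S: "submodule class_ring S (ob (tensor_sum I n) X)"
    and t: "\<And>u. u \<in> words (map n js) d \<Longrightarrow> word_tensor I n js X b u \<in> S"
    and x: "x \<in> carrier (ob (tensor_sum I n) X)" "\<And>i. i \<in> I - set js \<Longrightarrow> x i = \<zero>\<^bsub>tensor_power (n i) (fst X)\<^esub>"
  shows "x \<in> S"
proof -
  let ?V = "\<lambda>i. tensor_power (n i) (fst X)"
  note mX = is_cobj_module[OF X]
  have bc: "b ` {..<d} \<subseteq> carrier (fst X)"
    using b by (auto simp: orthonormal_frame_def orthonormal_family_def)
  have "direct_sum_inj I ?V i y \<in> S" if i: "i \<in> set js" and y: "y \<in> carrier (?V i)" for i y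
  proof -
    have iI: "i \<in> I" using i js by blast
    obtain h where h: "h < length js" "js ! h = i" using i by (auto simp: in_set_conv_nth)
    have "Module.module class_ring (direct_sum_cvs I ?V)"
      by (intro module_direct_sum module_tensor_power mX)
    moreover have "direct_sum_inj I ?V i \<in> module_hom class_ring (?V i) (direct_sum_cvs I ?V)"
      by (intro direct_sum_inj_hom module_tensor_power mX iI)
    ultimately have "submodule class_ring {y \<in> carrier (?V i). direct_sum_inj I ?V i y \<in> S} (?V i)"
      using S unfolding ob_tensor_sum by (intro submodule_vimage module_tensor_power mX)
    then have "{y \<in> carrier (?V i). direct_sum_inj I ?V i y \<in> S} = carrier (?V i)"
    proof (rule frame_tensors_span[OF mX _ bc])
      fix N assume N: "submodule class_ring N (fst X)" "b ` {..<d} \<subseteq> N"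
      have "x \<in> N" if "x \<in> carrier (fst X)" for x
      proof -
        have "lincomb_family (fst X) (\<lambda>i. snd X x (b i)) b {..<d} \<in> N"
          using bc N by (intro lincomb_family_mem[OF mX]) auto
        then show ?thesis using b that by (simp add: orthonormal_frame_def)
      qed
      then show "N = carrier (fst X)" using submodule.subset[OF N(1)] by blast
    next
      fix xs assume xs: "length xs = n i" "set xs \<subseteq> b ` {..<d}"
      then have "xs \<in> map b ` lists {..<d}" by (metis in_lists_conv_set lists_image subset_code(1))
      then obtain w where w: "xs = map b w" "set w \<subseteq> {..<d}" by auto
      have "h # w \<in> words (map n js) d" using h w xs by (auto simp: words_def)
      from t[OF this] have "direct_sum_inj I ?V i (pure_tensor (n i) (fst X) xs) \<in> S"
        by (simp add: word_tensor_def h w)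
      moreover have "xs \<in> tuples (n i) (fst X)" using xs bc by (auto simp: tuples_def)
      ultimately show "pure_tensor (n i) (fst X) xs \<in> {y \<in> carrier (?V i). direct_sum_inj I ?V i y \<in> S}"
        using pure_tensor_mem[OF mX] by blast
    qed
    with y show ?thesis by blast
  qed
  note inj = this
  show ?thesis
  proof (rule finitely_supported_mem[OF _ _ finite_set js])
    show "Module.module class_ring (?V i)" for i by (intro module_tensor_power mX)
    show "submodule class_ring S (direct_sum_cvs I ?V)" "x \<in> carrier (direct_sum_cvs I ?V)"
      using S x(1) by (simp_all only: ob_tensor_sum)
    show "x i = \<zero>\<^bsub>?V i\<^esub>" if "i \<in> I - set js" for i using x(2) that by blast
  qed (rule inj)
qed

end

section \<open>Leading words and reduction\<close>

text \<open>
  Coefficients are pushed forward along an injective map of indices and extended by zero.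
\<close>

lemma lincomb_family_pushforward:
  assumes V: "Module.module class_ring V" and t: "t \<in> B \<rightarrow> carrier V"
    and r: "r \<in> A \<rightarrow> B" "inj_on r A" and fin: "finite B"
  shows "lincomb_family V a (\<lambda>u. t (r u)) A =
    lincomb_family V (\<lambda>v. if v \<in> r ` A then a (the_inv_into A r v) else 0) t B"
proof -
  interpret V: Module.module "class_ring :: complex ring" V by (rule V)
  let ?a = "\<lambda>v. if v \<in> r ` A then a (the_inv_into A r v) else 0"
  have sub: "r ` A \<subseteq> B" using r by auto
  have "lincomb_family V a (\<lambda>u. t (r u)) A = (\<Oplus>\<^bsub>V\<^esub>u\<in>A. ?a (r u) \<odot>\<^bsub>V\<^esub> t (r u))"
    unfolding lincomb_family_def
    using t r by (intro V.finsum_cong') (auto simp: the_inv_into_f_f Pi_iff)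
  also have "\<dots> = (\<Oplus>\<^bsub>V\<^esub>v\<in>r ` A. ?a v \<odot>\<^bsub>V\<^esub> t v)"
    using t sub r(2) by (intro V.finsum_reindex[symmetric]) (auto simp: Pi_iff image_subset_iff)
  also have "\<dots> = (\<Oplus>\<^bsub>V\<^esub>v\<in>B. ?a v \<odot>\<^bsub>V\<^esub> t v)"
    using t sub fin V.lmult_0
    by (intro V.add.finprod_mono_neutral_cong_left) (auto simp: Pi_iff)
  finally show ?thesis unfolding lincomb_family_def .
qed

lemma wf_word_less: "wf word_less"
  unfolding word_less_def by (intro wf_lenlex wf_less_than)

text \<open>
  What the reduction argument needs to know about \<open>\<C>\<close>-modules: in every frame there is a family of vectors
  indexed by words, and morphisms between frames relabel the words.
\<close>

locale framed_cmodule =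
  fixes P :: "('v, 'm) cmodule" and ns :: "nat list"
    and t :: "'v cobj \<Rightarrow> (nat \<Rightarrow> 'v) \<Rightarrow> nat list \<Rightarrow> 'm"
  assumes ob_module: "is_cobj X \<Longrightarrow> Module.module class_ring (ob P X)"
    and mor_hom: "is_cobj X \<Longrightarrow> is_cobj Y \<Longrightarrow> g \<in> chom X Y \<Longrightarrow>
      mor P X Y g \<in> module_hom class_ring (ob P X) (ob P Y)"
    and word_mem: "is_cobj X \<Longrightarrow> orthonormal_frame X d b \<Longrightarrow> u \<in> words ns d \<Longrightarrow> t X b u \<in> carrier (ob P X)"
    and word_natural: "is_cobj X \<Longrightarrow> is_cobj Y \<Longrightarrow> g \<in> chom X Y \<Longrightarrow> orthonormal_frame X d b \<Longrightarrow>
      u \<in> words ns d \<Longrightarrow> (\<And>k. k < d \<Longrightarrow> g (b k) = b' (f k)) \<Longrightarrow>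
      mor P X Y g (t X b u) = t Y b' (relabel f u)"
begin

definition word_sum :: "'v cobj \<Rightarrow> nat \<Rightarrow> (nat \<Rightarrow> 'v) \<Rightarrow> (nat list \<Rightarrow> complex) \<Rightarrow> 'm" where
  "word_sum X d b c = lincomb_family (ob P X) c (t X b) (words ns d)"

definition leading_word :: "nat \<Rightarrow> (nat list \<Rightarrow> complex) \<Rightarrow> nat list \<Rightarrow> bool" where
  "leading_word d c u \<longleftrightarrow> u \<in> words ns d \<and> c u \<noteq> 0 \<and>
     (\<forall>v\<in>words ns d. c v \<noteq> 0 \<longrightarrow> v = u \<or> (v, u) \<in> word_less)"

lemma leading_word_ex: "u \<in> words ns d \<Longrightarrow> c u \<noteq> 0 \<Longrightarrow> \<exists>v. leading_word d c v"
proof -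
  assume "u \<in> words ns d" "c u \<noteq> 0"
  then have "{u \<in> words ns d. c u \<noteq> 0} \<noteq> {}" by blast
  moreover have "finite {u \<in> words ns d. c u \<noteq> 0}" using finite_words by simp
  ultimately obtain v where "v \<in> {u \<in> words ns d. c u \<noteq> 0}"
    "\<forall>w\<in>{u \<in> words ns d. c u \<noteq> 0}. w = v \<or> (w, v) \<in> word_less"
    using leading_word_exists by blast
  then show ?thesis unfolding leading_word_def by blast
qed

context
  fixes Y :: "'v cobj" and e :: nat and b' :: "nat \<Rightarrow> 'v"
  assumes Y: "is_cobj Y" and b': "orthonormal_frame Y e b'"
begin

lemma word_family: "t Y b' \<in> words ns e \<rightarrow> carrier (ob P Y)"
  using word_mem[OF Y b'] by blast

lemma word_sum_sub:
  assumes "\<And>u. u \<in> words ns e \<Longrightarrow> c u = c' u + s * c'' u"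
  shows "word_sum Y e b' c = word_sum Y e b' c' \<oplus>\<^bsub>ob P Y\<^esub> s \<odot>\<^bsub>ob P Y\<^esub> word_sum Y e b' c''"
proof -
  note M = ob_module[OF Y]
  have "word_sum Y e b' c = lincomb_family (ob P Y) (\<lambda>u. c' u + s * c'' u) (t Y b') (words ns e)"
    unfolding word_sum_def using assms by (intro lincomb_family_cong[OF M word_family]) auto
  also have "\<dots> = word_sum Y e b' c' \<oplus>\<^bsub>ob P Y\<^esub> s \<odot>\<^bsub>ob P Y\<^esub> word_sum Y e b' c''"
    unfolding word_sum_def
    by (simp add: lincomb_family_add[OF M word_family finite_words]
        lincomb_family_smult[OF M word_family finite_words])
  finally show ?thesis .
qed

lemma word_sums_submodule: "submodule class_ring (range (word_sum Y e b')) (ob P Y)"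
proof -
  note M = ob_module[OF Y]
  show ?thesis
  proof (rule submodule.intro[OF M])
    show "range (word_sum Y e b') \<subseteq> carrier (ob P Y)"
      unfolding word_sum_def using lincomb_family_closed[OF M word_family] by auto
    show "x \<oplus>\<^bsub>ob P Y\<^esub> y \<in> range (word_sum Y e b')"
      if "x \<in> range (word_sum Y e b')" "y \<in> range (word_sum Y e b')" for x y
      using that unfolding word_sum_def
      by (auto simp: lincomb_family_add[OF M word_family finite_words, symmetric])
    show "a \<odot>\<^bsub>ob P Y\<^esub> x \<in> range (word_sum Y e b')" if "x \<in> range (word_sum Y e b')" for a x
      using that unfolding word_sum_def
      by (auto simp: lincomb_family_smult[OF M word_family finite_words, symmetric])
    show "\<zero>\<^bsub>ob P Y\<^esub> \<in> range (word_sum Y e b')"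
      unfolding word_sum_def image_iff
      by (rule bexI[of _ "\<lambda>_. 0"]) (simp_all add: lincomb_family_eq_0[OF M word_family])
  qed
qed

lemma word_in_word_sums:
  assumes u: "u \<in> words ns e"
  shows "t Y b' u \<in> range (word_sum Y e b')"
proof -
  interpret Module.module "class_ring :: complex ring" "ob P Y" by (rule ob_module[OF Y])
  have "word_sum Y e b' (\<lambda>v. if v = u then 1 else 0) = t Y b' u"
    unfolding word_sum_def
    using lincomb_family_single[OF ob_module[OF Y] word_family finite_words u, of 1]
      smult_one[of "t Y b' u"] word_mem[OF Y b' u] by simp
  then show ?thesis by (metis rangeI)
qed

end

text \<open>
  The embedding \<open>f\<close> gives the isometry \<open>b\<^sub>k \<mapsto> b'\<^bsub>f k\<^esub>\<close>. It moves the coefficient at \<open>v\<close> to \<open>relabel f v\<close>; relabelling is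
  injective, so coefficients do not merge, and monotone, so the largest word stays largest.
\<close>

lemma leading_word_pushforward:
  assumes X: "is_cobj X" and Y: "is_cobj Y"
    and b: "orthonormal_frame X d b" and b': "orthonormal_frame Y e b'"
    and f: "f \<in> order_embeddings d e" and u: "leading_word d c u"
  shows "\<exists>g c'. g \<in> chom X Y \<and> leading_word e c' (relabel f u) \<and>
    mor P X Y g (word_sum X d b c) = word_sum Y e b' c'"
proof -
  have fd: "f k < e" if "k < d" for k
    using f that by (auto simp: order_embeddings_def)
  have finj: "f i = f j \<longleftrightarrow> i = j" if "i < d" "j < d" for i j
    using f that strict_mono_on_imp_inj_on[of "{..<d}" f] by (auto simp: order_embeddings_def inj_on_def)
  have "orthonormal_family Y d (\<lambda>k. b' (f k))"
    using b' fd finj unfolding orthonormal_frame_def orthonormal_family_def by (auto simp: Pi_iff)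
  then obtain g where g: "g \<in> chom X Y" "\<And>k. k < d \<Longrightarrow> g (b k) = b' (f k)"
    using isometry_from_frame[OF X Y b] by blast
  define A where "A = words ns d"
  define r where "r = relabel f"
  define c' where "c' v = (if v \<in> r ` A then c (the_inv_into A r v) else 0)" for v
  have inj: "inj_on r A" unfolding r_def A_def by (rule inj_on_relabel[OF f])
  have rA: "r \<in> A \<rightarrow> words ns e" unfolding r_def A_def using relabel_words[OF f] by blast
  have c'r: "c' (r v) = c v" if "v \<in> A" for v
    using that inj by (auto simp: c'_def the_inv_into_f_f)
  have "mor P X Y g (word_sum X d b c) = lincomb_family (ob P Y) c (\<lambda>v. mor P X Y g (t X b v)) A"
    unfolding word_sum_def A_def
    by (rule hom_lincomb_family[OF ob_module[OF X] word_family[OF X b] finite_words ob_module[OF Y] mor_hom[OF X Y g(1)]])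
  also have "\<dots> = lincomb_family (ob P Y) c (\<lambda>v. t Y b' (r v)) A"
  proof (rule lincomb_family_cong[OF ob_module[OF Y]])
    show "(\<lambda>v. mor P X Y g (t X b v)) \<in> A \<rightarrow> carrier (ob P Y)"
      using LinearCombinations.module_hom_closed[OF mor_hom[OF X Y g(1)]] word_family[OF X b]
      unfolding A_def by blast
    show "mor P X Y g (t X b v) = t Y b' (r v)" if "v \<in> A" for v
      unfolding r_def using word_natural[OF X Y g(1) b] g(2) that unfolding A_def by blast
  qed simp
  also have "\<dots> = word_sum Y e b' c'"
    unfolding word_sum_def c'_def
    by (rule lincomb_family_pushforward[OF ob_module[OF Y] word_family[OF Y b'] rA inj finite_words])
  finally have eq: "mor P X Y g (word_sum X d b c) = word_sum Y e b' c'" .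
  have "v = r u \<or> (v, r u) \<in> word_less" if "c' v \<noteq> 0" for v
  proof -
    have "v \<in> r ` A" using that unfolding c'_def by meson
    then obtain w where w: "w \<in> A" "v = r w" by blast
    then have "c w \<noteq> 0" using c'r that by auto
    then have "w = u \<or> (w, u) \<in> word_less" using u w unfolding leading_word_def A_def by blast
    then show ?thesis using w u relabel_word_less[OF f] unfolding leading_word_def A_def r_def by blast
  qed
  moreover have "r u \<in> words ns e" "c' (r u) \<noteq> 0"
    using u rA c'r unfolding leading_word_def A_def by auto
  ultimately have "leading_word e c' (r u)" unfolding leading_word_def by blast
  with g(1) eq show ?thesis unfolding r_def by blast
qed

text \<open>
  Collect the leading words of all elements of \<open>U\<close>, in all frames, and choose finitely many of which the others are
  relabellings. Elements with these leading words generate: given \<open>q\<close> in \<open>U\<close> with leading word \<open>v\<close>, the image of one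
  of them also has leading word \<open>v\<close>, and subtracting a multiple of it leaves an element of \<open>U\<close> with a smaller leading
  word. This stops because words are well-ordered.
\<close>

theorem csubmodule_word_sums_finitely_generated:
  assumes U: "is_csubmodule P U"
  shows "\<exists>G. finite G \<and> (\<forall>(Y, y)\<in>G. is_cobj Y \<and> y \<in> U Y) \<and>
    (\<forall>W X d b c. is_csubmodule P W \<longrightarrow> (\<forall>(Y, y)\<in>G. y \<in> W Y) \<longrightarrow> is_cobj X \<longrightarrow>
      orthonormal_frame X d b \<longrightarrow> word_sum X d b c \<in> U X \<longrightarrow> word_sum X d b c \<in> W X)"
proof -
  define witness where "witness d u = (\<lambda>(X, b, c). is_cobj X \<and> orthonormal_frame X d b \<and>
    leading_word d c u \<and> word_sum X d b c \<in> U X)" for d u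
  define L where "L = {(d, u). \<exists>z. witness d u z}"
  have "u \<in> words ns d" if "(d, u) \<in> L" for d u
    using that by (auto simp: L_def witness_def leading_word_def)
  then have "\<exists>B. finite B \<and> B \<subseteq> L \<and>
      (\<forall>(e, v)\<in>L. \<exists>(d, u)\<in>B. \<exists>f\<in>order_embeddings d e. relabel f u = v)"
    by (rule words_finite_basis)
  then obtain B where B: "finite B" "B \<subseteq> L"
    and basis: "\<forall>(e, v)\<in>L. \<exists>(d, u)\<in>B. \<exists>f\<in>order_embeddings d e. relabel f u = v"
    by (elim exE conjE)
  define z where "z = (\<lambda>(d, u). SOME z. witness d u z)"
  have z: "witness d u (z (d, u))" if "(d, u) \<in> B" for d u
  proof -
    have "(d, u) \<in> L" using B(2) that by blast
    then have "\<exists>z. witness d u z" unfolding L_def by simp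
    then show ?thesis unfolding z_def by (simp add: someI_ex)
  qed
  define G where "G = (\<lambda>(d, u). case z (d, u) of (X, b, c) \<Rightarrow> (X, word_sum X d b c)) ` B"
  have "finite G" using B(1) unfolding G_def by simp
  moreover have "\<forall>(Y, y)\<in>G. is_cobj Y \<and> y \<in> U Y"
  proof -
    have "case (case z p of (X, b, c) \<Rightarrow> (X, word_sum X (fst p) b c)) of (Y, y) \<Rightarrow> is_cobj Y \<and> y \<in> U Y"
      if "p \<in> B" for p
      using z[of "fst p" "snd p"] that by (cases "z p") (simp add: witness_def)
    then show ?thesis unfolding G_def by (auto simp: split_beta)
  qed
  moreover have "word_sum Y e b' c \<in> W Y"
    if W: "is_csubmodule P W" and G: "\<forall>(Y, y)\<in>G. y \<in> W Y"
      and Y: "is_cobj Y" and b': "orthonormal_frame Y e b'" and c: "word_sum Y e b' c \<in> U Y"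
    for W Y e b' c
  proof -
    interpret UY: submodule "class_ring :: complex ring" "U Y" "ob P Y"
      using U Y unfolding is_csubmodule_def VectorSpace.subspace_def by blast
    interpret WY: submodule "class_ring :: complex ring" "W Y" "ob P Y"
      using W Y unfolding is_csubmodule_def VectorSpace.subspace_def by blast
    have zero: "word_sum Y e b' c \<in> W Y" if "\<And>u. u \<in> words ns e \<Longrightarrow> c u = 0" for c
      unfolding word_sum_def using that WY.zero_closed
      by (simp add: lincomb_family_eq_0[OF ob_module[OF Y] word_family[OF Y b']])
    have "word_sum Y e b' c \<in> W Y" if "leading_word e c v" "word_sum Y e b' c \<in> U Y" for v c
      using that
    proof (induction v arbitrary: c rule: wf_induct_rule[OF wf_word_less])
      case (1 v)
      then have "(e, v) \<in> L" using Y b' unfolding L_def witness_def by blast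
      with basis obtain d u f where du: "(d, u) \<in> B" and f: "f \<in> order_embeddings d e" "relabel f u = v"
        by fast
      obtain X b c0 where z_eq: "z (d, u) = (X, b, c0)" by (cases "z (d, u)") auto
      have X: "is_cobj X" and b: "orthonormal_frame X d b" and lead: "leading_word d c0 u"
        and q0: "word_sum X d b c0 \<in> U X"
        using z[OF du] unfolding witness_def z_eq by auto
      have "(X, word_sum X d b c0) \<in> G" unfolding G_def using du z_eq by (intro image_eqI[of _ _ "(d, u)"]) simp_all
      then have q0W: "word_sum X d b c0 \<in> W X" using G by blast
      obtain g c1 where g: "g \<in> chom X Y" and lead1: "leading_word e c1 v"
        and c1: "mor P X Y g (word_sum X d b c0) = word_sum Y e b' c1"
        using leading_word_pushforward[OF X Y b b' f(1) lead] f(2) by blast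
      have c1U: "word_sum Y e b' c1 \<in> U Y"
        unfolding c1[symmetric] using U X Y g q0 unfolding is_csubmodule_def by blast
      have c1W: "word_sum Y e b' c1 \<in> W Y"
        unfolding c1[symmetric] using W X Y g q0W unfolding is_csubmodule_def by blast
      \<comment> \<open>The factor that cancels the leading coefficient.\<close>
      define s where "s = c v / c1 v"
      define c2 where "c2 w = c w + (- s) * c1 w" for w
      have "c2 v = 0" using lead1 by (simp add: c2_def s_def leading_word_def)
      have c2U: "word_sum Y e b' c2 \<in> U Y"
        unfolding word_sum_sub[OF Y b', of c2 c "- s" c1, OF c2_def]
        using 1(3) c1U by (intro UY.m_closed UY.smult_closed) auto
      have "word_sum Y e b' c2 \<in> W Y"
      proof (cases "\<forall>w\<in>words ns e. c2 w = 0")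
        case True
        then show ?thesis using zero by blast
      next
        case False
        then obtain v' where v': "leading_word e c2 v'" using leading_word_ex by blast
        then have "v' \<noteq> v" "c v' \<noteq> 0 \<or> c1 v' \<noteq> 0" "v' \<in> words ns e"
          using \<open>c2 v = 0\<close> by (auto simp: leading_word_def c2_def)
        then have "(v', v) \<in> word_less"
          using 1(2) lead1 unfolding leading_word_def by blast
        then show ?thesis using 1(1) v' c2U by blast
      qed
      moreover have "word_sum Y e b' c = word_sum Y e b' c2 \<oplus>\<^bsub>ob P Y\<^esub> s \<odot>\<^bsub>ob P Y\<^esub> word_sum Y e b' c1"
        by (rule word_sum_sub[OF Y b']) (simp add: c2_def)
      ultimately show ?case
        using c1W by (simp only:) (intro WY.m_closed WY.smult_closed, simp_all)
    qed
    then show ?thesis using zero leading_word_ex c by blast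
  qed
  ultimately show ?thesis by blast
qed

end

section \<open>Submodules and subquotients of \<open>\<C>\<close>-modules\<close>

lemma csubmodule_submodule:
  "is_csubmodule M S \<Longrightarrow> is_cobj X \<Longrightarrow> submodule class_ring (S X) (ob M X)"
  unfolding is_csubmodule_def VectorSpace.subspace_def by blast

lemma csubmodule_vectorspace:
  "is_csubmodule M S \<Longrightarrow> is_cobj X \<Longrightarrow> vectorspace class_ring (ob M X)"
  unfolding is_csubmodule_def VectorSpace.subspace_def by blast

lemma csubmodule_mor:
  "is_csubmodule M S \<Longrightarrow> is_cobj X \<Longrightarrow> is_cobj Y \<Longrightarrow> f \<in> chom X Y \<Longrightarrow> q \<in> S X \<Longrightarrow> mor M X Y f q \<in> S Y"
  unfolding is_csubmodule_def by blast

lemma carrier_csubmodule: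
  fixes M :: "('v, 'm) cmodule"
  assumes M: "is_cmodule M"
  shows "is_csubmodule M (\<lambda>X. carrier (ob M X))"
  unfolding is_csubmodule_def VectorSpace.subspace_def
proof (intro conjI allI impI)
  fix X :: "'v cobj" assume "is_cobj X"
  then show v: "vectorspace class_ring (ob M X)" using M unfolding is_cmodule_def by blast
  then show "submodule class_ring (carrier (ob M X)) (ob M X)"
    by (intro carrier_submodule) (simp add: vectorspace_def)
next
  fix X Y :: "'v cobj" and f assume "is_cobj X \<and> is_cobj Y \<and> f \<in> chom X Y"
  then have "mor M X Y f \<in> module_hom class_ring (ob M X) (ob M Y)"
    using M unfolding is_cmodule_def by blast
  then show "mor M X Y f ` carrier (ob M X) \<subseteq> carrier (ob M Y)"
    using LinearCombinations.module_hom_closed by blast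
qed

lemma csubmodule_select:
  "carrier (ob (csubmodule M S) X) = S X" "mor (csubmodule M S) = mor M"
  by (simp_all add: csubmodule_def)

lemma csubmodule_carrier: "csubmodule M (\<lambda>X. carrier (ob M X)) = M"
  by (simp add: csubmodule_def)

context
  fixes P :: "('v, 'p) cmodule" and M :: "('v, 'm) cmodule" and S \<phi>
  assumes P: "is_csubmodule P S" and M: "is_cmodule M"
    and \<phi>: "\<phi> \<in> cmodule_hom (csubmodule P S) M"
begin

lemma hom_on_csubmodule:
  assumes "is_cobj X"
  shows "x \<in> S X \<Longrightarrow> \<phi> X x \<in> carrier (ob M X)"
    and "x \<in> S X \<Longrightarrow> y \<in> S X \<Longrightarrow> \<phi> X (x \<oplus>\<^bsub>ob P X\<^esub> y) = \<phi> X x \<oplus>\<^bsub>ob M X\<^esub> \<phi> X y"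
    and "x \<in> S X \<Longrightarrow> \<phi> X (a \<odot>\<^bsub>ob P X\<^esub> x) = a \<odot>\<^bsub>ob M X\<^esub> \<phi> X x"
    and "\<phi> X \<zero>\<^bsub>ob P X\<^esub> = \<zero>\<^bsub>ob M X\<^esub>"
proof -
  have h: "\<phi> X \<in> module_hom class_ring (ob (csubmodule P S) X) (ob M X)"
    using \<phi> assms unfolding cmodule_hom_def by blast
  have c: "\<And>x. x \<in> S X \<Longrightarrow> \<phi> X x \<in> carrier (ob M X)"
    and s: "\<And>x a. x \<in> S X \<Longrightarrow> \<phi> X (a \<odot>\<^bsub>ob P X\<^esub> x) = a \<odot>\<^bsub>ob M X\<^esub> \<phi> X x"
    using h unfolding module_hom_def by (auto simp: csubmodule_def)
  show "x \<in> S X \<Longrightarrow> \<phi> X x \<in> carrier (ob M X)"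
    "x \<in> S X \<Longrightarrow> \<phi> X (a \<odot>\<^bsub>ob P X\<^esub> x) = a \<odot>\<^bsub>ob M X\<^esub> \<phi> X x"
    by (fact c s)+
  show "x \<in> S X \<Longrightarrow> y \<in> S X \<Longrightarrow> \<phi> X (x \<oplus>\<^bsub>ob P X\<^esub> y) = \<phi> X x \<oplus>\<^bsub>ob M X\<^esub> \<phi> X y"
    using h unfolding module_hom_def by (auto simp: csubmodule_def)
  interpret S: submodule "class_ring :: complex ring" "S X" "ob P X"
    by (rule csubmodule_submodule[OF P assms])
  interpret PX: vectorspace "class_ring :: complex ring" "ob P X"
    by (rule csubmodule_vectorspace[OF P assms])
  interpret MX: vectorspace "class_ring :: complex ring" "ob M X"
    using M assms unfolding is_cmodule_def by blast
  have "\<phi> X \<zero>\<^bsub>ob P X\<^esub> = 0 \<odot>\<^bsub>ob M X\<^esub> \<phi> X \<zero>\<^bsub>ob P X\<^esub>"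
    using s[OF S.zero_closed, of 0] PX.lmult_0[of "\<zero>\<^bsub>ob P X\<^esub>"] by simp
  also have "\<dots> = \<zero>\<^bsub>ob M X\<^esub>" using MX.lmult_0 c[OF S.zero_closed] by simp
  finally show "\<phi> X \<zero>\<^bsub>ob P X\<^esub> = \<zero>\<^bsub>ob M X\<^esub>" .
qed

lemma hom_on_csubmodule_natural:
  "is_cobj X \<Longrightarrow> is_cobj Y \<Longrightarrow> f \<in> chom X Y \<Longrightarrow> x \<in> S X \<Longrightarrow> \<phi> Y (mor P X Y f x) = mor M X Y f (\<phi> X x)"
  using \<phi> unfolding cmodule_hom_def csubmodule_select by blast

text \<open>
  Since \<open>\<phi>\<close> is a morphism on \<open>S\<close> only, the submodule to be mapped has to lie in \<open>S\<close>.
\<close>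

lemma csubmodule_image:
  assumes T: "is_csubmodule P T" and TS: "\<And>X. is_cobj X \<Longrightarrow> T X \<subseteq> S X"
  shows "is_csubmodule M (\<lambda>X. \<phi> X ` T X)"
  unfolding is_csubmodule_def VectorSpace.subspace_def
proof (intro conjI allI impI)
  fix X :: "'v cobj" assume X: "is_cobj X"
  show v: "vectorspace class_ring (ob M X)" using M X unfolding is_cmodule_def by blast
  interpret T: submodule "class_ring :: complex ring" "T X" "ob P X"
    by (rule csubmodule_submodule[OF T X])
  note h = hom_on_csubmodule[OF X] and sub = subsetD[OF TS[OF X]]
  show "submodule class_ring (\<phi> X ` T X) (ob M X)"
  proof (rule submodule.intro)
    show "Module.module class_ring (ob M X)" using v by (simp add: vectorspace_def)
    show "\<phi> X ` T X \<subseteq> carrier (ob M X)" using h(1) sub by blast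
    show "x \<oplus>\<^bsub>ob M X\<^esub> y \<in> \<phi> X ` T X" if xy: "x \<in> \<phi> X ` T X" "y \<in> \<phi> X ` T X" for x y
    proof -
      obtain x' y' where "x' \<in> T X" "x = \<phi> X x'" "y' \<in> T X" "y = \<phi> X y'" using xy by blast
      then show ?thesis using h(2)[of x' y'] sub T.m_closed by (metis imageI)
    qed
    show "a \<odot>\<^bsub>ob M X\<^esub> x \<in> \<phi> X ` T X" if x: "x \<in> \<phi> X ` T X" for a x
    proof -
      obtain x' where "x' \<in> T X" "x = \<phi> X x'" using x by blast
      then show ?thesis using h(3)[of x' a] sub T.smult_closed[of a x'] by (metis UNIV_I imageI partial_object.select_convs(1))
    qed
    show "\<zero>\<^bsub>ob M X\<^esub> \<in> \<phi> X ` T X" using h(4) T.zero_closed by (metis imageI)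
  qed
next
  fix X Y :: "'v cobj" and f assume "is_cobj X \<and> is_cobj Y \<and> f \<in> chom X Y"
  then have XY: "is_cobj X" "is_cobj Y" "f \<in> chom X Y" by auto
  show "mor M X Y f ` \<phi> X ` T X \<subseteq> \<phi> Y ` T Y"
  proof
    fix z assume "z \<in> mor M X Y f ` \<phi> X ` T X"
    then obtain x where x: "x \<in> T X" "z = mor M X Y f (\<phi> X x)" by blast
    then have "z = \<phi> Y (mor P X Y f x)" using hom_on_csubmodule_natural[OF XY subsetD[OF TS[OF XY(1)] x(1)]] by simp
    then show "z \<in> \<phi> Y ` T Y" using csubmodule_mor[OF T XY x(1)] by blast
  qed
qed

lemma csubmodule_vimage:
  assumes T: "is_csubmodule M T"
  shows "is_csubmodule P (\<lambda>X. {x \<in> S X. \<phi> X x \<in> T X})"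
  unfolding is_csubmodule_def VectorSpace.subspace_def
proof (intro conjI allI impI)
  fix X :: "'v cobj" assume X: "is_cobj X"
  show v: "vectorspace class_ring (ob P X)" by (rule csubmodule_vectorspace[OF P X])
  interpret S: submodule "class_ring :: complex ring" "S X" "ob P X"
    by (rule csubmodule_submodule[OF P X])
  interpret T: submodule "class_ring :: complex ring" "T X" "ob M X"
    by (rule csubmodule_submodule[OF T X])
  note h = hom_on_csubmodule[OF X]
  show "submodule class_ring {x \<in> S X. \<phi> X x \<in> T X} (ob P X)"
  proof (rule submodule.intro)
    show "Module.module class_ring (ob P X)" using v by (simp add: vectorspace_def)
    show "a \<odot>\<^bsub>ob P X\<^esub> x \<in> {x \<in> S X. \<phi> X x \<in> T X}" if "x \<in> {x \<in> S X. \<phi> X x \<in> T X}" for a x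
      using that h(3)[of x a] S.smult_closed[of a x] T.smult_closed[of a "\<phi> X x"] by simp
  qed (use h(2,4) S.subset in auto)
next
  fix X Y :: "'v cobj" and f assume "is_cobj X \<and> is_cobj Y \<and> f \<in> chom X Y"
  then have XY: "is_cobj X" "is_cobj Y" "f \<in> chom X Y" by auto
  show "mor P X Y f ` {x \<in> S X. \<phi> X x \<in> T X} \<subseteq> {x \<in> S Y. \<phi> Y x \<in> T Y}"
    using hom_on_csubmodule_natural[OF XY] csubmodule_mor[OF P XY] csubmodule_mor[OF T XY] by auto
qed

end

text \<open>
  The morphisms of the direct sum act on each component separately, so they do not enlarge the support.
\<close>

lemma supported_csubmodule:
  fixes I :: "'i set" and n :: "'i \<Rightarrow> nat" and S :: "'v cobj \<Rightarrow> ('i \<Rightarrow> ('v list \<Rightarrow> complex) set) set"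
  assumes S: "is_csubmodule (tensor_sum I n) S"
  shows "is_csubmodule (tensor_sum I n)
    (\<lambda>X. {q \<in> S X. \<forall>i\<in>I - J. q i = \<zero>\<^bsub>tensor_power (n i) (fst X)\<^esub>})"
  (is "is_csubmodule ?P _")
  unfolding is_csubmodule_def VectorSpace.subspace_def
proof (intro conjI allI impI)
  fix X :: "'v cobj" assume X: "is_cobj X"
  let ?Z = "{q \<in> S X. \<forall>i\<in>I - J. q i = \<zero>\<^bsub>tensor_power (n i) (fst X)\<^esub>}"
  show v: "vectorspace class_ring (ob ?P X)" by (rule csubmodule_vectorspace[OF S X])
  interpret S: submodule "class_ring :: complex ring" "S X" "ob ?P X"
    by (rule csubmodule_submodule[OF S X])
  have T: "Module.module class_ring (tensor_power k (fst X))" for k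
    by (intro module_tensor_power is_cobj_module X)
  note ops = ob_tensor_sum direct_sum_cvs_ops
  note z = component_simps[of I "\<lambda>i. tensor_power (n i) (fst X)", OF T]
  show "submodule class_ring ?Z (ob ?P X)"
  proof (rule submodule.intro)
    show "Module.module class_ring (ob ?P X)" using v by (simp add: vectorspace_def)
    show "x \<oplus>\<^bsub>ob ?P X\<^esub> y \<in> ?Z" if "x \<in> ?Z" "y \<in> ?Z" for x y
      using that S.m_closed[of x y] z(1) z(5) by (auto simp: ops)
    show "a \<odot>\<^bsub>ob ?P X\<^esub> x \<in> ?Z" if "x \<in> ?Z" for a x
      using that S.smult_closed[of a x] z(2) by (auto simp: ops)
    show "\<zero>\<^bsub>ob ?P X\<^esub> \<in> ?Z" using S.zero_closed by (auto simp: ops)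
  qed (use S.subset in auto)
next
  fix X Y :: "'v cobj" and f assume "is_cobj X \<and> is_cobj Y \<and> f \<in> chom X Y"
  then have XY: "is_cobj X" "is_cobj Y" "f \<in> chom X Y" by auto
  have "tensor_power_map k (fst Y) f \<zero>\<^bsub>tensor_power k (fst X)\<^esub> = \<zero>\<^bsub>tensor_power k (fst Y)\<^esub>" for k
    by (rule mod_hom.f0_is_0[OF mod_homI])
      (intro module_tensor_power tensor_power_map_hom is_cobj_module chom_hom XY)+
  then show "mor ?P X Y f ` {q \<in> S X. \<forall>i\<in>I - J. q i = \<zero>\<^bsub>tensor_power (n i) (fst X)\<^esub>}
      \<subseteq> {q \<in> S Y. \<forall>i\<in>I - J. q i = \<zero>\<^bsub>tensor_power (n i) (fst Y)\<^esub>}"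
    using csubmodule_mor[OF S XY] by (auto simp: mor_tensor_sum)
qed

section \<open>Subobjects of finitely generated algebraic \<open>\<C>\<close>-modules\<close>

lemma framed_tensor_sum:
  fixes I :: "'i set" and n :: "'i \<Rightarrow> nat"
  assumes "set js \<subseteq> I"
  shows "framed_cmodule (tensor_sum I n :: ('v, 'i \<Rightarrow> ('v list \<Rightarrow> complex) set) cmodule)
    (map n js) (word_tensor I n js)"
  (is "framed_cmodule ?P _ _")
proof (rule framed_cmodule.intro)
  fix X Y :: "'v cobj" and g d b u b' f
  assume "is_cobj X"
  then show "Module.module class_ring (ob ?P X)" by (rule module_tensor_sum)
  show "word_tensor I n js X b u \<in> carrier (ob ?P X)"
    if "orthonormal_frame X d b" "u \<in> words (map n js) d"
    using \<open>is_cobj X\<close> that by (rule word_tensor_mem[OF assms])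
  assume "is_cobj Y" "g \<in> chom X Y"
  with \<open>is_cobj X\<close> show "mor ?P X Y g \<in> module_hom class_ring (ob ?P X) (ob ?P Y)"
    by (rule mor_tensor_sum_hom)
  show "mor ?P X Y g (word_tensor I n js X b u) = word_tensor I n js Y b' (relabel f u)"
    if "orthonormal_frame X d b" "u \<in> words (map n js) d" "\<And>k. k < d \<Longrightarrow> g (b k) = b' (f k)"
    using \<open>is_cobj X\<close> \<open>is_cobj Y\<close> \<open>g \<in> chom X Y\<close> that by (rule word_tensor_natural[OF assms])
qed

theorem theorem2p11:
  fixes M :: "('v, 'm) cmodule" and N :: "('v, 'n) cmodule"
    and \<iota> :: "'v cobj \<Rightarrow> 'n \<Rightarrow> 'm"
  assumes "algebraic_cmodule TYPE('i) M"
    and "finitely_generated_cmodule M"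
    and "is_subobject N \<iota> M"
  shows "finitely_generated_cmodule N"
proof -
  have M: "is_cmodule M" and N: "is_cmodule N"
    and \<iota>: "\<iota> \<in> cmodule_hom N M" "\<And>X. is_cobj X \<Longrightarrow> inj_on (\<iota> X) (carrier (ob N X))"
    using assms unfolding algebraic_cmodule_def is_subobject_def by auto
  obtain I :: "'i set" and n :: "'i \<Rightarrow> nat" where
    "is_subquotient M (tensor_sum I n)"
    using assms(1) unfolding algebraic_cmodule_def by blast
  define P :: "('v, 'i \<Rightarrow> ('v list \<Rightarrow> complex) set) cmodule" where
    "P = tensor_sum I n"
  from \<open>is_subquotient M _\<close> obtain S \<phi> where S: "is_csubmodule P S"
    and \<phi>: "\<phi> \<in> cmodule_hom (csubmodule P S) M"
    and surj: "\<And>X. is_cobj X \<Longrightarrow> \<phi> X ` S X = carrier (ob M X)"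
    unfolding is_subquotient_def P_def by blast
  obtain GM where finGM: "finite GM" and GM': "\<forall>(Y, y)\<in>GM. is_cobj Y \<and> y \<in> carrier (ob M Y)"
    and genM: "\<forall>X. is_cobj X \<longrightarrow> generated_csubmodule M GM X = carrier (ob M X)"
    using assms(2) unfolding finitely_generated_cmodule_def by (elim exE conjE)
  have GM: "is_cobj Y \<and> y \<in> carrier (ob M Y)" if "(Y, y) \<in> GM" for Y y
    using GM' that by blast
  have "\<exists>q. q \<in> S Y \<and> \<phi> Y q = y" if "(Y, y) \<in> GM" for Y y
    using GM[OF that] surj by (metis imageE)
  then obtain lift where lift: "\<And>Y y. (Y, y) \<in> GM \<Longrightarrow> lift Y y \<in> S Y \<and> \<phi> Y (lift Y y) = y"
    by metis
  have S_sub: "q \<in> carrier (ob P X)" if "is_cobj X" "q \<in> S X" for X q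
    using submodule.subset[OF csubmodule_submodule[OF S that(1)]] that(2) by blast
  define supp where "supp Y y = {i \<in> I. lift Y y i \<noteq> \<zero>\<^bsub>tensor_power (n i) (fst Y)\<^esub>}" for Y y
  define J where "J = (\<Union>(Y, y)\<in>GM. supp Y y)"
  have "finite (supp Y y)" if "(Y, y) \<in> GM" for Y y
    using S_sub[of Y "lift Y y"] lift[OF that] GM[OF that]
    unfolding supp_def P_def ob_tensor_sum mem_direct_sum_cvs by blast
  then have "finite J" unfolding J_def using finGM by auto
  then obtain js where js: "set js = J" using finite_list by blast
  have J_sub: "set js \<subseteq> I" unfolding js J_def supp_def by auto
  define T where "T X = {q \<in> S X. \<forall>i\<in>I - J. q i = \<zero>\<^bsub>tensor_power (n i) (fst X)\<^esub>}" for X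
  have T: "is_csubmodule P T"
    unfolding T_def[abs_def] P_def by (rule supported_csubmodule[OF S[unfolded P_def]])
  have TM: "is_csubmodule M (\<lambda>X. \<phi> X ` T X)"
    by (rule csubmodule_image[OF S M \<phi> T]) (auto simp: T_def)
  have GMT: "y \<in> \<phi> Y ` T Y" if "(Y, y) \<in> GM" for Y y
  proof -
    have "lift Y y \<in> T Y" using lift[OF that] that by (auto simp: T_def J_def supp_def)
    then show ?thesis using lift[OF that] by (metis imageI)
  qed
  \<comment> \<open>The elements supported on the summands in \<open>J\<close> map onto \<open>M\<close>, because their image contains the generators.\<close>
  have lifts: "carrier (ob M X) \<subseteq> \<phi> X ` T X" if "is_cobj X" for X
  proof -
    have "generated_csubmodule M GM X \<subseteq> \<phi> X ` T X"
      unfolding generated_csubmodule_def using TM GMT by blast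
    then show ?thesis using genM that by simp
  qed

  interpret F: framed_cmodule P "map n js" "word_tensor I n js"
    unfolding P_def by (rule framed_tensor_sum[OF J_sub])
  have \<iota>': "\<iota> \<in> cmodule_hom (csubmodule N (\<lambda>X. carrier (ob N X))) M"
    using \<iota>(1) by (simp only: csubmodule_carrier)
  note imageN = csubmodule_image[OF carrier_csubmodule[OF N] M \<iota>']
  \<comment> \<open>For \<open>W = C\<close>, the whole of \<open>N\<close>, this is the submodule to which the reduction argument applies.
    For a submodule \<open>W\<close> containing preimages in \<open>N\<close> of the generators found there, \<open>U W\<close> contains these generators.\<close>
  define U where "U W X = {q \<in> S X. \<phi> X q \<in> \<iota> X ` W X}" for W X
  have U: "is_csubmodule P (U W)" if "is_csubmodule N W" for W
  proof -
    have "W X \<subseteq> carrier (ob N X)" if "is_cobj X" for X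
      using submodule.subset[OF csubmodule_submodule[OF \<open>is_csubmodule N W\<close> that]] .
    then show ?thesis
      unfolding U_def[abs_def] by (intro csubmodule_vimage[OF S M \<phi>] imageN that)
  qed
  define C where "C X = carrier (ob N X)" for X
  have C: "is_csubmodule N C" unfolding C_def[abs_def] by (rule carrier_csubmodule[OF N])
  obtain G where finG: "finite G" and G': "\<forall>(Y, y)\<in>G. is_cobj Y \<and> y \<in> U C Y"
    and genU: "\<forall>W X d b c. is_csubmodule P W \<longrightarrow> (\<forall>(Y, y)\<in>G. y \<in> W Y) \<longrightarrow> is_cobj X \<longrightarrow>
      orthonormal_frame X d b \<longrightarrow> F.word_sum X d b c \<in> U C X \<longrightarrow> F.word_sum X d b c \<in> W X"
    using F.csubmodule_word_sums_finitely_generated[OF U[OF C]] by (elim exE conjE)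
  have G: "is_cobj Y \<and> y \<in> U C Y" if "(Y, y) \<in> G" for Y y
    using G' that by blast
  have "\<exists>m. m \<in> C Y \<and> \<iota> Y m = \<phi> Y y" if "(Y, y) \<in> G" for Y y
  proof -
    have "\<phi> Y y \<in> \<iota> Y ` C Y" using G[OF that] unfolding U_def by simp
    then obtain m where "\<phi> Y y = \<iota> Y m" "m \<in> C Y" by (rule imageE)
    then show ?thesis by (intro exI[of _ m]) simp
  qed
  then obtain pre where pre: "\<And>Y y. (Y, y) \<in> G \<Longrightarrow> pre Y y \<in> C Y \<and> \<iota> Y (pre Y y) = \<phi> Y y"
    by metis
  define GN where "GN = (\<lambda>(Y, y). (Y, pre Y y)) ` G"
  have "finite GN" using finG by (simp add: GN_def)
  moreover have GN: "\<forall>(Y, y)\<in>GN. is_cobj Y \<and> y \<in> carrier (ob N Y)"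
    using G pre unfolding GN_def C_def by auto
  moreover have "generated_csubmodule N GN X = carrier (ob N X)" if X: "is_cobj X" for X
  proof
    show "generated_csubmodule N GN X \<subseteq> carrier (ob N X)"
      unfolding generated_csubmodule_def using carrier_csubmodule[OF N] GN by blast
    \<comment> \<open>Lift \<open>m\<close> to an element \<open>q\<close> of \<open>U C\<close> with support in \<open>J\<close>. Since \<open>U W\<close> contains \<open>G\<close>, it contains \<open>q\<close>,
      and \<open>m\<close> lies in \<open>W\<close> because \<open>\<iota>\<close> is injective.\<close>
    have "m \<in> W X" if W: "is_csubmodule N W" "\<forall>(Y, y)\<in>GN. y \<in> W Y" and m: "m \<in> carrier (ob N X)" for W m
    proof -
      have W_sub: "W X \<subseteq> carrier (ob N X)"
        using submodule.subset[OF csubmodule_submodule[OF W(1) X]] .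
      have "\<iota> X m \<in> carrier (ob M X)"
        using hom_on_csubmodule(1)[OF carrier_csubmodule[OF N] M \<iota>' X m] .
      then have "\<iota> X m \<in> \<phi> X ` T X" using lifts[OF X] by blast
      then obtain q where "\<iota> X m = \<phi> X q" and qT: "q \<in> T X" by (rule imageE)
      then have q: "q \<in> T X" "\<phi> X q = \<iota> X m" by simp_all
      have qU: "q \<in> U C X" using q m unfolding U_def T_def C_def by auto
      obtain d b where b: "orthonormal_frame X d b"
        using quadratic_space.orthonormal_frame_exists X is_cobj_iff_quadratic_space by (metis prod.collapse)
      have "q \<in> range (F.word_sum X d b)"
      proof (rule word_tensors_span[OF J_sub X b])
        show "submodule class_ring (range (F.word_sum X d b)) (ob (tensor_sum I n) X)"
          using F.word_sums_submodule[OF X b] unfolding P_def .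
        show "q \<in> carrier (ob (tensor_sum I n) X)"
          using S_sub[OF X] q unfolding T_def P_def by auto
        show "word_tensor I n js X b u \<in> range (F.word_sum X d b)" if "u \<in> words (map n js) d" for u
          by (rule F.word_in_word_sums[OF X b that])
        show "q i = \<zero>\<^bsub>tensor_power (n i) (fst X)\<^esub>" if "i \<in> I - set js" for i
          using q that unfolding T_def js by blast
      qed
      then obtain c where c: "q = F.word_sum X d b c" by blast
      have "\<forall>(Y, y)\<in>G. y \<in> U W Y"
      proof (intro ballI, clarify)
        fix Y y assume Yy: "(Y, y) \<in> G"
        then have "pre Y y \<in> W Y" using W(2) unfolding GN_def by auto
        then have "\<phi> Y y \<in> \<iota> Y ` W Y" using pre[OF Yy] by (metis imageI)
        then show "y \<in> U W Y" using G[OF Yy] unfolding U_def by blast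
      qed
      then have "q \<in> U W X" using genU U[OF W(1)] X b qU unfolding c by blast
      then obtain m' where "m' \<in> W X" "\<iota> X m = \<iota> X m'" using q(2) unfolding U_def by auto
      then have "m = m'" using \<iota>(2)[OF X] m W_sub by (auto dest: inj_onD)
      then show "m \<in> W X" using \<open>m' \<in> W X\<close> by simp
    qed
    then show "carrier (ob N X) \<subseteq> generated_csubmodule N GN X"
      unfolding generated_csubmodule_def by blast
  qed
  ultimately show ?thesis unfolding finitely_generated_cmodule_def by blast
qed

end
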